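(* For every claw-free bridgeless cubic graph $G$, $\nu_3(G) \geq \frac{43}{45}\cdot |E(G)|$.
   Context: Graphs are finite, without loops, possibly with multiple edges; a graph is cubic if every vertex has degree $3$, bridgeless if it has no edge whose removal increases the number of connected components, and claw-free if it has no induced subgraph isomorphic to $K_{1,3}$. $\nu_3(G)$ is the maximum number of edges of a $3$-edge-colorable subgraph of $G$. *)

theory Defs
  imports Complex_Main
begin

text \<open>A finite multigraph without loops: vertex set V, edge set E, and an endpoint
  map ends assigning to every edge a set of exactly two distinct vertices.
  Parallel edges are distinct elements of E with the same ends.\<close>

definition multigraph :: "'v set \<Rightarrow> 'e set \<Rightarrow> ('e \<Rightarrow> 'v set) \<Rightarrow> bool" where
  "multigraph V E ends \<longleftrightarrow> finite V \<and> finite E \<and>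
     (\<forall>e\<in>E. ends e \<subseteq> V \<and> card (ends e) = 2)"

definition degree :: "'e set \<Rightarrow> ('e \<Rightarrow> 'v set) \<Rightarrow> 'v \<Rightarrow> nat" where
  "degree E ends v = card {e\<in>E. v \<in> ends e}"

definition cubic :: "'v set \<Rightarrow> 'e set \<Rightarrow> ('e \<Rightarrow> 'v set) \<Rightarrow> bool" where
  "cubic V E ends \<longleftrightarrow> (\<forall>v\<in>V. degree E ends v = 3)"

definition conn_rel :: "'v set \<Rightarrow> 'e set \<Rightarrow> ('e \<Rightarrow> 'v set) \<Rightarrow> ('v \<times> 'v) set" where
  "conn_rel V E ends = {(u, w). u \<in> V \<and> w \<in> V \<and>
     (u, w) \<in> ({(x, y). \<exists>e\<in>E. ends e = {x, y}})\<^sup>*}"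

definition num_components :: "'v set \<Rightarrow> 'e set \<Rightarrow> ('e \<Rightarrow> 'v set) \<Rightarrow> nat" where
  "num_components V E ends = card (V // conn_rel V E ends)"

definition is_bridge :: "'v set \<Rightarrow> 'e set \<Rightarrow> ('e \<Rightarrow> 'v set) \<Rightarrow> 'e \<Rightarrow> bool" where
  "is_bridge V E ends e \<longleftrightarrow> e \<in> E \<and>
     num_components V (E - {e}) ends > num_components V E ends"

definition bridgeless :: "'v set \<Rightarrow> 'e set \<Rightarrow> ('e \<Rightarrow> 'v set) \<Rightarrow> bool" where
  "bridgeless V E ends \<longleftrightarrow> (\<forall>e\<in>E. \<not> is_bridge V E ends e)"

definition mult :: "'e set \<Rightarrow> ('e \<Rightarrow> 'v set) \<Rightarrow> 'v \<Rightarrow> 'v \<Rightarrow> nat" where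
  "mult E ends u w = card {e\<in>E. ends e = {u, w}}"

definition claw_free :: "'v set \<Rightarrow> 'e set \<Rightarrow> ('e \<Rightarrow> 'v set) \<Rightarrow> bool" where
  "claw_free V E ends \<longleftrightarrow> \<not> (\<exists>v a b c. v \<in> V \<and> a \<in> V \<and> b \<in> V \<and> c \<in> V \<and>
     distinct [v, a, b, c] \<and>
     mult E ends v a = 1 \<and> mult E ends v b = 1 \<and> mult E ends v c = 1 \<and>
     mult E ends a b = 0 \<and> mult E ends a c = 0 \<and> mult E ends b c = 0)"

definition three_edge_colorable :: "'e set \<Rightarrow> ('e \<Rightarrow> 'v set) \<Rightarrow> bool" where
  "three_edge_colorable F ends \<longleftrightarrow> (\<exists>col :: 'e \<Rightarrow> nat.
     (\<forall>e\<in>F. col e < 3) \<and>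
     (\<forall>e1\<in>F. \<forall>e2\<in>F. e1 \<noteq> e2 \<and> ends e1 \<inter> ends e2 \<noteq> {} \<longrightarrow> col e1 \<noteq> col e2))"

definition nu3 :: "'e set \<Rightarrow> ('e \<Rightarrow> 'v set) \<Rightarrow> nat" where
  "nu3 E ends = Max {card F | F. F \<subseteq> E \<and> three_edge_colorable F ends}"

end

theory Submission
  imports Defs
begin

text \<open>
  Suppressing a digon or contracting a triangle of a bridgeless cubic graph yields a bridgeless
  cubic graph, and colorings lift back without uncoloring further edges. Iterating leads to a
  graph H of girth at least 4. A perfect matching of H (Petersen's theorem) leaves a 2-factor whose
  odd cycles have length at least 5; deleting one edge from each of them makes H 3-edge-colorable,
  so at most |V(H)|/5 edges are lost. If G is claw-free, every vertex lies in a triangle or a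
  digon, so every vertex of H arises from a contraction and accounts for at least 3 vertices of G.
  Hence at most |V(G)|/15 = 2|E(G)|/45 edges are lost.
\<close>

section \<open>Bridges and cuts\<close>

text \<open>Claw-freeness does not survive contraction, since a contracted vertex may have three
  pairwise nonadjacent neighbours. The induction therefore assumes a triangle or a digon only at the
  vertices outside a set S that collects the contracted ones, and it bounds the loss in terms of
  card V + 2 * card S, a quantity that no reduction increases. Bridges enter only as cuts with
  exactly one edge. Every vertex set of a reduced graph corresponds to a vertex set of the original
  graph whose cut has the same size, so the condition passes through each reduction at once, whereas
  component counts would have to be traced. It also excludes a digon whose two outer neighbours
  coincide, where suppression would create a loop. Cycles never appear as walks: edge sets in which
  every degree is 0 or 2 take their place, so that parity and counting replace traversal.\<close>

lemma multigraphD: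
  assumes "multigraph V E ends"
  shows "finite V" "finite E" "\<And>e. e \<in> E \<Longrightarrow> ends e \<subseteq> V" "\<And>e. e \<in> E \<Longrightarrow> card (ends e) = 2"
    "\<And>e. e \<in> E \<Longrightarrow> finite (ends e)"
  using assms unfolding multigraph_def by (auto intro: card_ge_0_finite)

lemma finite_if_card_2: "card A = 2 \<Longrightarrow> finite A"
  by (rule card_ge_0_finite) simp

lemma other_end:
  assumes "card A = 2" "x \<in> A"
  obtains y where "A = {x, y}" "y \<noteq> x"
  using assms by (metis card_2_iff insert_commute insertE singletonD)

text \<open>For edges with two ends this is the usual edge boundary of X, written without choosing
  endpoints.\<close>

definition cut :: "'e set \<Rightarrow> ('e \<Rightarrow> 'v set) \<Rightarrow> 'v set \<Rightarrow> 'e set" where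
  "cut E ends X = {e\<in>E. ends e \<inter> X \<noteq> {} \<and> \<not> ends e \<subseteq> X}"

definition bridge_cut_free :: "'v set \<Rightarrow> 'e set \<Rightarrow> ('e \<Rightarrow> 'v set) \<Rightarrow> bool" where
  "bridge_cut_free V E ends \<longleftrightarrow> (\<forall>X\<subseteq>V. card (cut E ends X) \<noteq> 1)"

lemma equiv_conn_rel: "equiv V (conn_rel V E ends)"
proof -
  let ?r = "{(x, y). \<exists>e\<in>E. ends e = {x, y}}"
  have "sym ?r" by (auto simp: sym_def insert_commute)
  then have "sym (?r\<^sup>*)" by (rule sym_rtrancl)
  then show ?thesis
    unfolding equiv_def refl_on_def sym_def trans_def conn_rel_def
    by (auto intro: rtrancl_trans)
qed

text \<open>Sending an s-class to the r-class containing it is onto. It stays onto when the class of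
  u is left out, because the class of w is a different s-class with the same image; so the coarser
  relation has strictly fewer classes.\<close>

lemma card_quotient_less:
  assumes "finite V" "equiv V r" "equiv V s" "s \<subseteq> r" "(u, w) \<in> r" "(u, w) \<notin> s"
  shows "card (V // r) < card (V // s)"
proof -
  have uV: "u \<in> V" "w \<in> V" using assms(2,5) by (auto simp: equiv_def refl_on_def)
  let ?h = "\<lambda>C. r `` C"
  have h: "?h (s `` {x}) = r `` {x}" if "x \<in> V" for x
  proof -
    have "(x, x) \<in> s" using assms(3) that by (auto simp: equiv_def refl_on_def)
    moreover have "trans r" using assms(2) by (simp add: equiv_def)
    ultimately show ?thesis using assms(4) by (auto dest: transD)
  qed
  have fin: "finite (V // s)" by (rule finite_quotient[OF assms(1)]) (use assms(3) in \<open>auto simp: equiv_def refl_on_def\<close>)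
  have img: "?h ` (V // s - {s `` {u}}) = V // r"
  proof
    show "?h ` (V // s - {s `` {u}}) \<subseteq> V // r"
      using h by (auto simp: quotient_def)
    show "V // r \<subseteq> ?h ` (V // s - {s `` {u}})"
    proof
      fix C assume "C \<in> V // r"
      then obtain x where x: "x \<in> V" "C = r `` {x}" by (auto simp: quotient_def)
      show "C \<in> ?h ` (V // s - {s `` {u}})"
      proof (cases "s `` {x} = s `` {u}")
        case False
        then have "s `` {x} \<in> V // s - {s `` {u}}" using x by (simp add: quotientI)
        then show ?thesis using x h[OF x(1)] by (metis imageI)
      next
        case True
        have "(x, u) \<in> s" using True assms(3) uV x(1) by (simp add: eq_equiv_class_iff)
        then have "(x, w) \<in> r" using assms(2,4,5) by (meson equivE subsetD transD)
        then have C: "C = r `` {w}" using x assms(2) by (simp add: equiv_class_eq)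
        have "s `` {w} \<noteq> s `` {u}" using assms(3,6) uV by (metis eq_equiv_class_iff)
        then have "s `` {w} \<in> V // s - {s `` {u}}" using uV by (simp add: quotientI)
        then show ?thesis using C h[OF uV(2)] by (metis imageI)
      qed
    qed
  qed
  have "card (V // r) \<le> card (V // s - {s `` {u}})"
    using card_image_le[of "V // s - {s `` {u}}" ?h] fin img by simp
  also have "\<dots> < card (V // s)"
    using fin uV by (intro psubset_card_mono) (auto simp: quotient_def)
  finally show ?thesis .
qed

text \<open>If e is the only edge in the cut of X, a walk that avoids e and starts in X never leaves
  X. Deleting e thus separates its ends, refines connectivity strictly and raises the number of
  components.\<close>

lemma bridgeless_imp_bridge_cut_free:
  assumes G: "multigraph V E ends" and "bridgeless V E ends"
  shows "bridge_cut_free V E ends"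
  unfolding bridge_cut_free_def
proof (intro allI impI notI)
  fix X assume X: "X \<subseteq> V" "card (cut E ends X) = 1"
  then obtain e where e: "cut E ends X = {e}" by (meson card_1_singletonE)
  then have eE: "e \<in> E" "ends e \<inter> X \<noteq> {}" "\<not> ends e \<subseteq> X" by (auto simp: cut_def)
  then obtain u where u: "u \<in> ends e" "u \<in> X" by blast
  then obtain w where w: "ends e = {u, w}" "w \<noteq> u"
    using other_end multigraphD(4)[OF G eE(1)] by metis
  then have wX: "w \<notin> X" using eE u by auto
  let ?r = "conn_rel V E ends" and ?s = "conn_rel V (E - {e}) ends"
  have "(u, w) \<notin> {(x, y). \<exists>d\<in>E - {e}. ends d = {x, y}}\<^sup>*"
  proof
    assume "(u, w) \<in> {(x, y). \<exists>d\<in>E - {e}. ends d = {x, y}}\<^sup>*"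
    then have "w \<in> X"
    proof induction
      case (step y z)
      then obtain d where d: "d \<in> E - {e}" "ends d = {y, z}" by auto
      then have "d \<notin> cut E ends X" using e by auto
      then show ?case using d step by (auto simp: cut_def)
    qed (use u in simp)
    then show False using wX by simp
  qed
  then have 1: "(u, w) \<notin> ?s" by (simp add: conn_rel_def)
  have 2: "(u, w) \<in> ?r"
    using eE w multigraphD(3)[OF G eE(1)] by (auto simp: conn_rel_def intro!: r_into_rtrancl)
  have 3: "?s \<subseteq> ?r"
    unfolding conn_rel_def using rtrancl_mono[of "{(x, y). \<exists>d\<in>E - {e}. ends d = {x, y}}" "{(x, y). \<exists>d\<in>E. ends d = {x, y}}"]
    by blast
  have "card (V // ?r) < card (V // ?s)"
    by (rule card_quotient_less[OF multigraphD(1)[OF G] equiv_conn_rel equiv_conn_rel 3 2 1])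
  then have "is_bridge V E ends e" by (simp add: is_bridge_def num_components_def eE)
  then show False using assms(2) eE by (auto simp: bridgeless_def)
qed

lemma sum_degree:
  assumes "finite E" "finite C"
  shows "(\<Sum>v\<in>C. degree E ends v) = (\<Sum>e\<in>E. card (ends e \<inter> C))"
proof -
  have "(\<Sum>v\<in>C. card {e\<in>E. v \<in> ends e}) = (\<Sum>e\<in>E. card {v\<in>C. v \<in> ends e})"
    by (rule sum_multicount_gen[symmetric]) (use assms in auto)
  moreover have "{v\<in>C. v \<in> ends e} = ends e \<inter> C" for e by auto
  ultimately show ?thesis by (simp add: degree_def)
qed

text \<open>Counting incidences at C gives 3 * card C, where a cut edge contributes one and any
  other edge zero or two.\<close>

lemma cubic_cut_parity:
  assumes G: "multigraph V E ends" and "cubic V E ends" "C \<subseteq> V"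
  shows "even (card (cut E ends C)) \<longleftrightarrow> even (card C)"
proof -
  have fC: "finite C" using assms(3) multigraphD(1)[OF G] by (rule finite_subset)
  have "3 * card C = (\<Sum>v\<in>C. degree E ends v)"
    using assms(2,3) by (simp add: cubic_def subset_iff)
  also have "\<dots> = (\<Sum>e\<in>E. card (ends e \<inter> C))"
    by (rule sum_degree[OF multigraphD(2)[OF G] fC])
  also have "\<dots> = (\<Sum>e\<in>cut E ends C. card (ends e \<inter> C)) + (\<Sum>e\<in>E - cut E ends C. card (ends e \<inter> C))"
    by (subst add.commute, rule sum.subset_diff) (auto simp: cut_def multigraphD(2)[OF G])
  also have "(\<Sum>e\<in>cut E ends C. card (ends e \<inter> C)) = card (cut E ends C)"
  proof -
    have "card (ends e \<inter> C) = 1" if "e \<in> cut E ends C" for e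
    proof -
      have e: "e \<in> E" "ends e \<inter> C \<noteq> {}" "\<not> ends e \<subseteq> C" using that by (auto simp: cut_def)
      then obtain u where "u \<in> ends e" "u \<in> C" by blast
      moreover then obtain w where "ends e = {u, w}" "w \<noteq> u"
        using other_end multigraphD(4)[OF G e(1)] by metis
      ultimately have "ends e \<inter> C = {u}" using e by auto
      then show ?thesis by simp
    qed
    then show ?thesis by simp
  qed
  finally have "3 * card C = card (cut E ends C) + (\<Sum>e\<in>E - cut E ends C. card (ends e \<inter> C))" .
  moreover have "even (\<Sum>e\<in>E - cut E ends C. card (ends e \<inter> C))"
  proof (rule dvd_sum)
    fix e assume "e \<in> E - cut E ends C"
    then have "ends e \<inter> C = {} \<or> ends e \<inter> C = ends e" "card (ends e) = 2"
      using multigraphD(4)[OF G] by (auto simp: cut_def)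
    then show "even (card (ends e \<inter> C))" by auto
  qed
  ultimately show ?thesis by (metis even_add even_mult_iff odd_numeral)
qed

section \<open>Petersen's theorem\<close>

definition matching :: "'e set \<Rightarrow> ('e \<Rightarrow> 'v set) \<Rightarrow> 'e set \<Rightarrow> bool" where
  "matching E ends M \<longleftrightarrow> M \<subseteq> E \<and> (\<forall>e\<in>M. \<forall>f\<in>M. e \<noteq> f \<longrightarrow> ends e \<inter> ends f = {})"

definition max_matching :: "'e set \<Rightarrow> ('e \<Rightarrow> 'v set) \<Rightarrow> 'e set \<Rightarrow> bool" where
  "max_matching E ends M \<longleftrightarrow> matching E ends M \<and> (\<forall>N. matching E ends N \<longrightarrow> card N \<le> card M)"

lemma card_covered:
  assumes "multigraph V E ends" "matching E ends M"
  shows "card (\<Union>(ends ` M)) = 2 * card M"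
proof -
  have "M \<subseteq> E" using assms by (simp add: matching_def)
  then have "finite M" "\<forall>e\<in>M. finite (ends e)" "\<forall>e\<in>M. card (ends e) = 2"
    using multigraphD[OF assms(1)] by (blast intro: finite_subset)+
  moreover have "\<forall>e\<in>M. \<forall>f\<in>M. e \<noteq> f \<longrightarrow> ends e \<inter> ends f = {}" using assms by (simp add: matching_def)
  ultimately show ?thesis by (subst card_UN_disjoint) auto
qed

lemma ex_max_matching:
  assumes "finite E"
  obtains M where "max_matching E ends M"
proof -
  have "matching E ends {}" by (simp add: matching_def)
  moreover have "\<forall>N. matching E ends N \<longrightarrow> card N < Suc (card E)"
    using assms by (auto simp: matching_def less_Suc_eq_le intro: card_mono)
  ultimately have "\<exists>M. matching E ends M \<and> (\<forall>N. matching E ends N \<longrightarrow> card N \<le> card M)"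
    by (rule ex_has_greatest_nat)
  then show ?thesis using that by (auto simp: max_matching_def)
qed

text \<open>
  Transitivity, at a vertex t missed by some maximum matching, of the relation ``no maximum matching
  misses both''. Take maximum matchings M missing u, v and N missing t with largest intersection;
  a suitable exchange of one edge of N for an edge of M enlarges the intersection.
\<close>

lemma gallai_trans:
  assumes G: "multigraph V E ends"
    and ut: "\<And>M. max_matching E ends M \<Longrightarrow> u \<in> \<Union>(ends ` M) \<or> t \<in> \<Union>(ends ` M)"
    and tv: "\<And>M. max_matching E ends M \<Longrightarrow> t \<in> \<Union>(ends ` M) \<or> v \<in> \<Union>(ends ` M)"
    and uv: "u \<noteq> v"
    and N0: "max_matching E ends N0" "t \<notin> \<Union>(ends ` N0)"
    and M0: "max_matching E ends M0"
  shows "u \<in> \<Union>(ends ` M0) \<or> v \<in> \<Union>(ends ` M0)"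
proof (rule ccontr)
  assume contra: "\<not> ?thesis"
  note fE = multigraphD(2)[OF G]
  define P where "P = (\<lambda>(M, N). max_matching E ends M \<and> u \<notin> \<Union>(ends ` M) \<and> v \<notin> \<Union>(ends ` M)
     \<and> max_matching E ends N \<and> t \<notin> \<Union>(ends ` N))"
  have "P (M0, N0)" using contra N0 M0 by (auto simp: P_def)
  moreover have "\<forall>p. P p \<longrightarrow> (\<lambda>(M, N). card (M \<inter> N)) p < Suc (card E)"
    using fE by (auto simp: P_def max_matching_def matching_def less_Suc_eq_le intro!: card_mono)
  ultimately have "\<exists>p. P p \<and> (\<forall>q. P q \<longrightarrow> (\<lambda>(M, N). card (M \<inter> N)) q \<le> (\<lambda>(M, N). card (M \<inter> N)) p)"
    by (rule ex_has_greatest_nat)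
  then obtain M N where "P (M, N)" and best: "\<And>M' N'. P (M', N') \<Longrightarrow> card (M' \<inter> N') \<le> card (M \<inter> N)"
    by auto
  then have M: "max_matching E ends M" "u \<notin> \<Union>(ends ` M)" "v \<notin> \<Union>(ends ` M)"
    and N: "max_matching E ends N" "t \<notin> \<Union>(ends ` N)" by (auto simp: P_def)
  have mM: "matching E ends M" and mN: "matching E ends N" and eq: "card M = card N"
    using M N by (auto simp: max_matching_def intro: antisym)
  have sub: "M \<subseteq> E" "N \<subseteq> E" using mM mN by (auto simp: matching_def)
  let ?A = "\<Union>(ends ` M)" and ?B = "\<Union>(ends ` N)"
  have fin: "finite ?A" "finite ?B" "finite M" "finite N"
    using sub finite_subset[OF _ fE] multigraphD(5)[OF G] by blast+
  \<comment> \<open>Equally large matchings cover equally many vertices, so the two vertices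
    \<open>u\<close> and \<open>v\<close> covered only by \<open>N\<close> force at least two
    covered only by \<open>M\<close>; one of these is not \<open>t\<close>.\<close>
  have cAB: "card ?A = card ?B"
    using card_covered[OF G] mM mN eq by simp
  have uvB: "{u, v} \<subseteq> ?B - ?A" using ut[OF N(1)] tv[OF N(1)] N M by auto
  have "card {u, v} \<le> card (?B - ?A)" using uvB fin by (intro card_mono) auto
  then have "2 \<le> card (?A - ?B)"
    using uv cAB card_le_sym_Diff[of ?A ?B] card_le_sym_Diff[of ?B ?A] fin by simp
  then have "\<not> ?A - ?B \<subseteq> {t}"
    by (metis card_mono card.empty card_insert_if finite.emptyI finite_insert empty_iff not_numeral_le_zero numeral_le_one_iff order.trans semiring_norm(69) One_nat_def)
  then obtain x where x: "x \<in> ?A" "x \<notin> ?B" "x \<noteq> t" by auto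
  then obtain e where e: "e \<in> M" "x \<in> ends e" by auto
  then obtain y where y: "ends e = {x, y}" "y \<noteq> x"
    using other_end multigraphD(4)[OF G] sub by (metis subsetD)
  have eN: "e \<notin> N" using x e by auto
  have "y \<in> ?B"
  proof (rule ccontr)
    assume "y \<notin> ?B"
    then have "matching E ends (insert e N)"
      using mN x y e sub by (auto simp: matching_def)
    then have "card (insert e N) \<le> card N" using N by (simp add: max_matching_def)
    then show False using eN fin by simp
  qed
  then obtain f where f: "f \<in> N" "y \<in> ends f" by auto
  have fM: "f \<notin> M"
  proof
    assume "f \<in> M"
    moreover have "ends f \<inter> ends e \<noteq> {}" using f y by auto
    ultimately have "f = e" using mM e by (auto simp: matching_def)
    then show False using f eN by simp
  qed
  \<comment> \<open>\<open>e\<close> replaces \<open>f\<close>. The new matching still misses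
    \<open>t\<close>, which differs from \<open>x\<close> and \<open>y\<close>, and it shares the
    additional edge \<open>e\<close> with \<open>M\<close>, whereas \<open>f\<close> was not
    shared.\<close>
  let ?N = "insert e (N - {f})"
  have y_only: "y \<notin> ends g" if "g \<in> N" "g \<noteq> f" for g
    using mN f that unfolding matching_def by blast
  have m': "matching E ends ?N"
    using mN x y e sub y_only by (auto simp: matching_def)
  have "card ?N = card N" using card.remove[OF fin(4) f(1)] fin eN by (subst card_insert_disjoint) auto
  then have max': "max_matching E ends ?N" using N m' by (simp add: max_matching_def)
  have "t \<noteq> y" using f N by auto
  then have "P (M, ?N)" using M max' N x y by (auto simp: P_def)
  then have "card (M \<inter> ?N) \<le> card (M \<inter> N)" by (rule best)
  moreover have "M \<inter> ?N = insert e (M \<inter> N)" using e fM by auto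
  ultimately show False using eN fin by simp
qed

text \<open>
  The family need not consist of all odd components of the graph without U; this avoids counting
  components. If every vertex is missed by some maximum matching, U is empty and the family consists
  of the components of the vertices missed by a fixed maximum matching.
\<close>

lemma tutte_berge:
  assumes "multigraph V E ends"
  shows "\<exists>M U \<C>. matching E ends M \<and> U \<subseteq> V \<and> finite \<C> \<and> pairwise disjnt \<C> \<and>
    (\<forall>C\<in>\<C>. C \<subseteq> V - U \<and> odd (card C) \<and> (\<forall>e\<in>E. ends e \<inter> C \<noteq> {} \<longrightarrow> ends e \<subseteq> C \<union> U)) \<and>
    card V + card U \<le> 2 * card M + card \<C>"
  using assms
proof (induction "card V" arbitrary: V E)
  case 0
  then have "V = {}" by (simp add: multigraph_def)
  then show ?case
    by (intro exI[of _ "{}"]) (auto simp: matching_def pairwise_def disjnt_def)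
next
  case (Suc n)
  note G = \<open>multigraph V E ends\<close>
  note fV = multigraphD(1)[OF G] and fE = multigraphD(2)[OF G]
  obtain M where M: "max_matching E ends M" using ex_max_matching[OF fE] .
  then have mM: "matching E ends M" by (simp add: max_matching_def)
  show ?case
  proof (cases "\<exists>v\<in>V. \<forall>N. max_matching E ends N \<longrightarrow> v \<in> \<Union>(ends ` N)")
    case True
    then obtain v where v: "v \<in> V" "\<And>N. max_matching E ends N \<Longrightarrow> v \<in> \<Union>(ends ` N)" by blast
    let ?E = "{e\<in>E. v \<notin> ends e}"
    have G': "multigraph (V - {v}) ?E ends"
      using G by (auto simp: multigraph_def)
    have "n = card (V - {v})" using Suc.hyps(2) v fV by simp
    from Suc.hyps(1)[OF this G'] obtain M' U \<C> where
      *: "matching ?E ends M'" "U \<subseteq> V - {v}" "finite \<C>" "pairwise disjnt \<C>"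
      "\<forall>C\<in>\<C>. C \<subseteq> V - {v} - U \<and> odd (card C) \<and> (\<forall>e\<in>?E. ends e \<inter> C \<noteq> {} \<longrightarrow> ends e \<subseteq> C \<union> U)"
      "card (V - {v}) + card U \<le> 2 * card M' + card \<C>" by (elim exE conjE) (rule that)
    have m': "matching E ends M'" "v \<notin> \<Union>(ends ` M')" using *(1) by (auto simp: matching_def)
    then have "\<not> max_matching E ends M'" using v by blast
    then have "card M' < card M"
      using m' M unfolding max_matching_def by (meson le_trans not_less)
    moreover have "card (insert v U) = Suc (card U)"
    proof -
      have "finite U" by (rule finite_subset[OF *(2)]) (simp add: fV)
      moreover have "v \<notin> U" using *(2) by auto
      ultimately show ?thesis by simp
    qed
    moreover have "card V = Suc (card (V - {v}))" by (rule card.remove[OF fV v(1)])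
    \<comment> \<open>Relative to the bound for the smaller graph, the left side grows by two, once
      for \<open>v\<close> in the vertex set and once for \<open>v\<close> in U; the right side
      grows by at least two, since \<open>M\<close> has at least one edge more than
      \<open>M'\<close>.\<close>
    ultimately have "card V + card (insert v U) \<le> 2 * card M + card \<C>" using *(6) by linarith
    moreover have "\<forall>C\<in>\<C>. C \<subseteq> V - insert v U \<and> odd (card C)
        \<and> (\<forall>e\<in>E. ends e \<inter> C \<noteq> {} \<longrightarrow> ends e \<subseteq> C \<union> insert v U)"
    proof (intro ballI conjI impI)
      fix C assume C: "C \<in> \<C>"
      show "C \<subseteq> V - insert v U" "odd (card C)" using bspec[OF *(5) C] by auto
      fix e assume e: "e \<in> E" "ends e \<inter> C \<noteq> {}"
      \<comment> \<open>Edges at \<open>v\<close> are absent from the smaller graph; here they have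
        one end in C, and the other is \<open>v\<close>, which now belongs to the enlarged
        U.\<close>
      show "ends e \<subseteq> C \<union> insert v U"
      proof (cases "v \<in> ends e")
        case True
        then obtain y where "ends e = {v, y}" using other_end multigraphD(4)[OF G e(1)] by metis
        then show ?thesis using e bspec[OF *(5) C] by auto
      next
        case False
        then show ?thesis using e bspec[OF *(5) C] by auto
      qed
    qed
    ultimately show ?thesis using mM * v by (intro exI[of _ M] exI[of _ "insert v U"] exI[of _ \<C>]) auto
  next
    case False
    then have miss: "\<And>v. v \<in> V \<Longrightarrow> \<exists>N. max_matching E ends N \<and> v \<notin> \<Union>(ends ` N)" by blast
    let ?r = "{(x, y). \<exists>e\<in>E. ends e = {x, y}}"
    have sym: "sym (?r\<^sup>*)" by (rule sym_rtrancl) (auto simp: sym_def insert_commute)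
    \<comment> \<open>Induction along a walk: adjacent vertices are never missed together by a
      maximum matching, since the joining edge could be added, and \<open>gallai_trans\<close>
      extends this to the whole component.\<close>
    have gallai: "u = v \<or> (\<forall>N. max_matching E ends N \<longrightarrow> u \<in> \<Union>(ends ` N) \<or> v \<in> \<Union>(ends ` N))"
      if "(u, v) \<in> ?r\<^sup>*" for u v
      using that
    proof induction
      case base
      then show ?case by simp
    next
      case (step t v)
      then obtain e where e: "e \<in> E" "ends e = {t, v}" by auto
      have tV: "t \<in> V" using e multigraphD(3)[OF G] by auto
      have tv: "t \<in> \<Union>(ends ` N) \<or> v \<in> \<Union>(ends ` N)" if N: "max_matching E ends N" for N
      proof (rule ccontr)
        assume c: "\<not> ?thesis"
        have mN: "matching E ends N" using N by (simp add: max_matching_def)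
        have eN: "e \<notin> N" using c e by auto
        have "matching E ends (insert e N)" using mN c e by (auto simp: matching_def)
        then have "card (insert e N) \<le> card N" using N by (simp add: max_matching_def)
        moreover have "finite N" using mN fE by (auto simp: matching_def intro: finite_subset)
        ultimately show False using eN by simp
      qed
      show ?case
      proof (cases "u = t \<or> u = v")
        case True
        then show ?thesis using tv by auto
      next
        case False
        then have ut: "\<And>N. max_matching E ends N \<Longrightarrow> u \<in> \<Union>(ends ` N) \<or> t \<in> \<Union>(ends ` N)"
          using step.IH by blast
        obtain N0 where "max_matching E ends N0" "t \<notin> \<Union>(ends ` N0)" using miss[OF tV] by blast
        then show ?thesis using gallai_trans[OF G ut tv _ ] False by blast
      qed
    qed
    \<comment> \<open>A component contains at most one vertex missed by \<open>M\<close>. So the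
      missed vertices have distinct components, and \<open>M\<close> matches all other vertices of
      each, which makes these components odd. Their number is card V - 2 * card M, exactly what the
      inequality asks for with U empty.\<close>
    let ?W = "V - \<Union>(ends ` M)" and ?C = "\<lambda>v. ?r\<^sup>* `` {v}"
    have CV: "?C v \<subseteq> V" if "v \<in> V" for v
    proof
      fix x assume "x \<in> ?C v"
      then have "(v, x) \<in> ?r\<^sup>*" by simp
      then show "x \<in> V" using that by induction (use multigraphD(3)[OF G] in auto)
    qed
    have closed: "ends e \<subseteq> ?C v" if e: "e \<in> E" "ends e \<inter> ?C v \<noteq> {}" for e v
    proof -
      obtain x where x: "x \<in> ends e" "x \<in> ?C v" using e by blast
      then obtain y where "ends e = {x, y}" using other_end multigraphD(4)[OF G e(1)] by metis
      then show ?thesis using x e by (auto intro: rtrancl_into_rtrancl)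
    qed
    have disj: "?C u \<inter> ?C v = {}" if "u \<in> ?W" "v \<in> ?W" "u \<noteq> v" for u v
    proof (rule ccontr)
      assume "?C u \<inter> ?C v \<noteq> {}"
      then obtain x where "(u, x) \<in> ?r\<^sup>*" "(v, x) \<in> ?r\<^sup>*" by auto
      then have "(u, v) \<in> ?r\<^sup>*" using sym by (meson rtrancl_trans symD)
      then show False using gallai[of u v] M that by blast
    qed
    have odd: "odd (card (?C v))" if v: "v \<in> ?W" for v
    proof -
      let ?M = "{e\<in>M. ends e \<subseteq> ?C v}"
      have cov: "\<Union>(ends ` ?M) = ?C v - {v}"
      proof
        show "\<Union>(ends ` ?M) \<subseteq> ?C v - {v}" using v by auto
        show "?C v - {v} \<subseteq> \<Union>(ends ` ?M)"
        proof
          fix x assume x: "x \<in> ?C v - {v}"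
          have "x \<in> \<Union>(ends ` M)"
            using gallai[of v x] M x v by auto
          then obtain e where "e \<in> M" "x \<in> ends e" by auto
          moreover then have "ends e \<subseteq> ?C v"
            using closed[of e v] x mM by (auto simp: matching_def)
          ultimately show "x \<in> \<Union>(ends ` ?M)" by auto
        qed
      qed
      have "matching E ends ?M" using mM by (auto simp: matching_def)
      then have "card (?C v - {v}) = 2 * card ?M"
        using card_covered[OF G, of ?M] unfolding cov by blast
      then have "even (card (?C v - {v}))" by (rule dvdI)
      moreover have "finite (?C v)" by (rule finite_subset[OF CV fV]) (use v in blast)
      then have "card (?C v) = Suc (card (?C v - {v}))" by (rule card.remove) simp
      then have "even (card (?C v)) \<longleftrightarrow> odd (card (?C v - {v}))" by (simp only: even_Suc)
      ultimately show ?thesis by blast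
    qed
    have inj: "inj_on ?C ?W"
    proof (rule inj_onI, rule ccontr)
      fix u v assume "u \<in> ?W" "v \<in> ?W" "?C u = ?C v" "u \<noteq> v"
      then show False using disj[of u v] by auto
    qed
    have "\<Union>(ends ` M) \<subseteq> V" using mM multigraphD(3)[OF G] by (auto simp: matching_def)
    then have "card ?W = card V - 2 * card M" "2 * card M \<le> card V"
      using card_covered[OF G mM] fV card_mono[OF fV, of "\<Union>(ends ` M)"]
      by (auto simp: card_Diff_subset finite_subset)
    then have "card V + card ({}::'a set) \<le> 2 * card M + card (?C ` ?W)"
      using card_image[OF inj] by simp
    moreover have "pairwise disjnt (?C ` ?W)"
      using disj by (auto simp: pairwise_def disjnt_def)
    moreover have "\<forall>C\<in>?C ` ?W. C \<subseteq> V - {} \<and> odd (card C) \<and> (\<forall>e\<in>E. ends e \<inter> C \<noteq> {} \<longrightarrow> ends e \<subseteq> C \<union> {})"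
      using CV closed odd by simp
    ultimately show ?thesis using mM fV
      by (intro exI[of _ M] exI[of _ "{}"] exI[of _ "?C ` ?W"]) simp
  qed
qed

text \<open>Every member of the family sends an odd number of edges to U, and not just one, hence at
  least three; these cuts are disjoint and U receives at most 3 * card U edges. So the family has at
  most card U members, and the inequality of \<open>tutte_berge\<close> leaves no vertex
  uncovered.\<close>

lemma petersen_perfect_matching:
  assumes G: "multigraph V E ends" and cub: "cubic V E ends" and bf: "bridge_cut_free V E ends"
  obtains M where "matching E ends M" "\<Union>(ends ` M) = V"
proof -
  note fV = multigraphD(1)[OF G] and fE = multigraphD(2)[OF G]
  obtain M U \<C> where
    *: "matching E ends M" "U \<subseteq> V" "finite \<C>" "pairwise disjnt \<C>"
    and C': "\<forall>C\<in>\<C>. C \<subseteq> V - U \<and> odd (card C) \<and> (\<forall>e\<in>E. ends e \<inter> C \<noteq> {} \<longrightarrow> ends e \<subseteq> C \<union> U)"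
    and le: "card V + card U \<le> 2 * card M + card \<C>"
    using tutte_berge[OF G] by (elim exE conjE) (rule that)
  note C = bspec[OF C']
  have fU: "finite U" using *(2) fV by (rule finite_subset)
  have ge3: "3 \<le> card (cut E ends C)" if "C \<in> \<C>" for C
  proof -
    have "C \<subseteq> V" "odd (card C)" using C[OF that] by auto
    then have "odd (card (cut E ends C))" "card (cut E ends C) \<noteq> 1"
      using cubic_cut_parity[OF G cub] bf by (auto simp: bridge_cut_free_def)
    moreover have "odd n \<Longrightarrow> n \<noteq> 1 \<Longrightarrow> 3 \<le> n" for n :: nat by presburger
    ultimately show ?thesis by blast
  qed
  have disj: "cut E ends C \<inter> cut E ends D = {}" if "C \<in> \<C>" "D \<in> \<C>" "C \<noteq> D" for C D
  proof (rule ccontr)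
    assume "cut E ends C \<inter> cut E ends D \<noteq> {}"
    then obtain e where e: "e \<in> E" "ends e \<inter> C \<noteq> {}" "ends e \<inter> D \<noteq> {}" "\<not> ends e \<subseteq> C"
      by (auto simp: cut_def)
    have "C \<inter> D = {}" using *(4) that by (auto simp: pairwise_def disjnt_def)
    moreover have "ends e \<subseteq> C \<union> U" "C \<inter> U = {}" "D \<inter> U = {}" using C that e by blast+
    ultimately show False using e by blast
  qed
  have fc: "finite (cut E ends X)" for X using fE by (simp add: cut_def)
  have "3 * card \<C> \<le> (\<Sum>C\<in>\<C>. card (cut E ends C))"
    using sum_mono[of \<C> "\<lambda>_. 3" "\<lambda>C. card (cut E ends C)"] ge3 by (simp add: mult.commute)
  also have "\<dots> = card (\<Union>C\<in>\<C>. cut E ends C)"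
    using disj fc *(3) by (subst card_UN_disjoint) auto
  also have "\<dots> \<le> card (\<Union>u\<in>U. {e\<in>E. u \<in> ends e})"
  proof (rule card_mono)
    show "finite (\<Union>u\<in>U. {e\<in>E. u \<in> ends e})" using fU fE by auto
    show "(\<Union>C\<in>\<C>. cut E ends C) \<subseteq> (\<Union>u\<in>U. {e\<in>E. u \<in> ends e})"
      using C by (fastforce simp: cut_def)
  qed
  also have "\<dots> \<le> (\<Sum>u\<in>U. card {e\<in>E. u \<in> ends e})" by (rule card_UN_le[OF fU])
  also have "\<dots> = 3 * card U" using cub *(2) by (simp add: cubic_def degree_def subset_iff)
  finally have "card V \<le> 2 * card M" using le by simp
  then have "card V \<le> card (\<Union>(ends ` M))"
    using card_covered[OF G *(1)] by simp
  moreover have "\<Union>(ends ` M) \<subseteq> V" using *(1) multigraphD(3)[OF G] by (auto simp: matching_def)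
  ultimately have "\<Union>(ends ` M) = V" using fV by (simp add: card_seteq)
  then show ?thesis using that *(1) by blast
qed

section \<open>Edge colorings of graphs of maximum degree 2\<close>

text \<open>The number of colours is a parameter because two colours serve outside a perfect
  matching and three serve the whole graph.\<close>

definition proper :: "('e \<Rightarrow> 'v set) \<Rightarrow> nat \<Rightarrow> 'e set \<Rightarrow> ('e \<Rightarrow> nat) \<Rightarrow> bool" where
  "proper ends k F col \<longleftrightarrow> (\<forall>e\<in>F. col e < k) \<and>
     (\<forall>e\<in>F. \<forall>f\<in>F. e \<noteq> f \<and> ends e \<inter> ends f \<noteq> {} \<longrightarrow> col e \<noteq> col f)"

text \<open>For finitely many edges with two ends, these are the disjoint unions of cycles, with two
  parallel edges counting as a cycle; a minimal nonempty one is a single cycle. The empty set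
  qualifies too.\<close>

definition even_regular :: "('e \<Rightarrow> 'v set) \<Rightarrow> 'e set \<Rightarrow> bool" where
  "even_regular ends D \<longleftrightarrow> (\<forall>v. degree D ends v = 0 \<or> degree D ends v = 2)"

lemma degree_mono: "finite F \<Longrightarrow> D \<subseteq> F \<Longrightarrow> degree D ends v \<le> degree F ends v"
  unfolding degree_def by (rule card_mono) auto

lemma degree_0_iff: "finite F \<Longrightarrow> degree F ends v = 0 \<longleftrightarrow> (\<forall>e\<in>F. v \<notin> ends e)"
  by (auto simp: degree_def)

text \<open>The end x meets no coloured edge and y at most one, so one of the two colours is free at
  both ends.\<close>

lemma proper_insert_pendant:
  assumes "finite F" "proper ends 2 F col" "e \<notin> F" "ends e = {x, y}"
    and "degree F ends x = 0" "degree F ends y \<le> 1"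
  shows "\<exists>col. proper ends 2 (insert e F) col"
proof -
  have "\<exists>c<2. \<forall>f\<in>F. y \<in> ends f \<longrightarrow> col f \<noteq> c"
  proof (cases "\<exists>f\<in>F. y \<in> ends f")
    case True
    then obtain f where f: "f \<in> F" "y \<in> ends f" by blast
    have "g = f" if "g \<in> F" "y \<in> ends g" for g
      using assms(6) f that assms(1) card_le_Suc0_iff_eq[of "{e\<in>F. y \<in> ends e}"] by (auto simp: degree_def)
    then show ?thesis by (intro exI[of _ "if col f = 0 then 1 else 0"]) (auto split: if_splits)
  qed (auto intro: exI[of _ 0])
  then obtain c where c: "c < 2" "\<And>f. f \<in> F \<Longrightarrow> y \<in> ends f \<Longrightarrow> col f \<noteq> c" by blast
  have x: "\<And>f. f \<in> F \<Longrightarrow> x \<notin> ends f" using assms by (simp add: degree_0_iff)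
  have "proper ends 2 (insert e F) (col(e := c))"
    using assms(2,3,4) c x unfolding proper_def
    by (auto simp: Int_insert_left Int_insert_right split: if_splits)
  then show ?thesis by blast
qed

text \<open>A nonempty F is itself not \<open>even_regular\<close>, so with maximum degree 2 it has
  a vertex of degree 1. The edge at this vertex is removed and coloured last.\<close>

lemma forest_two_colorable:
  assumes "finite F" "\<And>e. e \<in> F \<Longrightarrow> card (ends e) = 2" "\<And>v. degree F ends v \<le> 2"
    and "\<And>D. D \<subseteq> F \<Longrightarrow> even_regular ends D \<Longrightarrow> D = {}"
  shows "\<exists>col. proper ends 2 F col"
  using assms
proof (induction "card F" arbitrary: F rule: less_induct)
  case less
  note fF = less.prems(1)
  show ?case
  proof (cases "F = {}")
    case True
    then show ?thesis by (auto simp: proper_def)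
  next
    case False
    then have "\<not> even_regular ends F" using less.prems(4)[of F] by auto
    then obtain x where "degree F ends x \<noteq> 0" "degree F ends x \<noteq> 2" by (auto simp: even_regular_def)
    moreover have "degree F ends x \<le> 2" by (rule less.prems(3))
    ultimately have "card {e\<in>F. x \<in> ends e} = 1" by (simp add: degree_def)
    then obtain e where e: "{e\<in>F. x \<in> ends e} = {e}" by (rule card_1_singletonE)
    then have eF: "e \<in> F" "x \<in> ends e" by auto
    then obtain y where y: "ends e = {x, y}" "y \<noteq> x" using other_end less.prems(2) by metis
    have sm: "card (F - {e}) < card F" using eF fF by (metis card_Diff1_less)
    have "degree (F - {e}) ends v \<le> 2" for v
      using degree_mono[of F "F - {e}" ends v] fF less.prems(3)[of v] by auto
    then obtain col where col: "proper ends 2 (F - {e}) col"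
      using less.hyps[OF sm] less.prems by blast
    have "{g\<in>F - {e}. y \<in> ends g} = {g\<in>F. y \<in> ends g} - {e}" by auto
    then have "degree (F - {e}) ends y \<le> 1"
      using less.prems(3)[of y] eF y fF by (simp add: degree_def card_Diff_singleton)
    moreover have "degree (F - {e}) ends x = 0" using e fF by (auto simp: degree_0_iff)
    ultimately have "\<exists>col. proper ends 2 (insert e (F - {e})) col"
      using proper_insert_pendant[of "F - {e}" ends col e x y] col y fF by auto
    then show ?thesis using eF by (simp add: insert_absorb)
  qed
qed

text \<open>Double counting of incidences: two per edge and two per covered vertex.\<close>

lemma even_regular_card:
  assumes "finite D" "\<And>e. e \<in> D \<Longrightarrow> card (ends e) = 2" "even_regular ends D"
  shows "card (\<Union>(ends ` D)) = card D"
proof -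
  let ?W = "\<Union>(ends ` D)"
  have fin: "finite ?W" using assms(1,2) by (auto intro: finite_if_card_2)
  have "(\<Sum>v\<in>?W. degree D ends v) = (\<Sum>e\<in>D. card (ends e \<inter> ?W))"
    by (rule sum_degree[OF assms(1) fin])
  moreover have "card (ends e \<inter> ?W) = 2" if "e \<in> D" for e
    using that assms(2)[OF that] by (metis Int_absorb2 UN_upper)
  moreover have "degree D ends v = 2" if "v \<in> ?W" for v
    using that assms(1,3) by (fastforce simp: even_regular_def degree_0_iff)
  ultimately show ?thesis by simp
qed

text \<open>A parity argument replaces walking along the cycle. If the two edges next to e had
  different colours, the colour class of one of them would be a matching that covers every vertex
  but one end of e; the number of vertices, and with it card D, would be odd. So both have the same
  colour and e takes the other one.\<close>

lemma proper_close_even_cycle: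
  assumes fD: "finite D" and c2: "\<And>e. e \<in> D \<Longrightarrow> card (ends e) = 2" and reg: "even_regular ends D"
    and "even (card D)" "e \<in> D" and col: "proper ends 2 (D - {e}) col"
  shows "\<exists>col. proper ends 2 D col"
proof -
  have G: "multigraph (\<Union>(ends ` D)) D ends"
    using fD c2 by (auto simp: multigraph_def intro: finite_if_card_2)
  have two: "\<exists>f. f \<noteq> e' \<and> {g\<in>D. v \<in> ends g} = {e', f}" if "e' \<in> D" "v \<in> ends e'" for v e'
  proof -
    have "degree D ends v \<noteq> 0" using that fD by (auto simp: degree_0_iff)
    then have "card {g\<in>D. v \<in> ends g} = 2" using reg by (metis even_regular_def degree_def)
    then show ?thesis using other_end[of "{g\<in>D. v \<in> ends g}" e'] that by (metis (mono_tags, lifting) mem_Collect_eq)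
  qed
  obtain x y where xy: "ends e = {x, y}" "x \<noteq> y" using c2[OF assms(5)] by (auto simp: card_2_iff)
  obtain p where p: "p \<noteq> e" "{g\<in>D. x \<in> ends g} = {e, p}" using two[of e x] xy assms(5) by auto
  obtain q where q: "q \<noteq> e" "{g\<in>D. y \<in> ends g} = {e, q}" using two[of e y] xy assms(5) by auto
  have pD: "p \<in> D" "x \<in> ends p" "q \<in> D" "y \<in> ends q" using p q by blast+
  have lt: "\<And>g. g \<in> D \<Longrightarrow> g \<noteq> e \<Longrightarrow> col g < 2" using col by (auto simp: proper_def)
  have ne: "\<And>g h. g \<in> D \<Longrightarrow> h \<in> D \<Longrightarrow> g \<noteq> e \<Longrightarrow> h \<noteq> e \<Longrightarrow> g \<noteq> h \<Longrightarrow> ends g \<inter> ends h \<noteq> {} \<Longrightarrow> col g \<noteq> col h"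
    using col by (auto simp: proper_def)
  have eq: "col p = col q"
  proof (rule ccontr)
    assume neq: "col p \<noteq> col q"
    let ?D0 = "{g\<in>D - {e}. col g = col p}"
    \<comment> \<open>Off the ends of \<open>e\<close>, a vertex meets two coloured edges and hence
      both colours; \<open>x\<close> is covered by \<open>p\<close>, whereas at \<open>y\<close> the
      only coloured edge is \<open>q\<close>.\<close>
    have cov: "\<Union>(ends ` ?D0) = \<Union>(ends ` D) - {y}"
    proof (intro equalityI subsetI)
      fix v assume "v \<in> \<Union>(ends ` ?D0)"
      then obtain g where g: "g \<in> D" "g \<noteq> e" "col g = col p" "v \<in> ends g" by auto
      have "v \<noteq> y"
      proof
        assume "v = y"
        then have "g \<in> {e, q}" using g q by auto
        then show False using g neq by auto
      qed
      then show "v \<in> \<Union>(ends ` D) - {y}" using g by auto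
    next
      fix v assume "v \<in> \<Union>(ends ` D) - {y}"
      then obtain g where g: "g \<in> D" "v \<in> ends g" "v \<noteq> y" by auto
      show "v \<in> \<Union>(ends ` ?D0)"
      proof (cases "v = x")
        case True
        then show ?thesis using pD p by auto
      next
        case False
        obtain h where h: "h \<noteq> g" "{g'\<in>D. v \<in> ends g'} = {g, h}" using two[OF g(1,2)] by blast
        then have hD: "h \<in> D" "v \<in> ends h" by blast+
        have "g \<noteq> e" "h \<noteq> e" using False g hD xy by auto
        then have "col g \<noteq> col h" "col g < 2" "col h < 2" "col p < 2"
          using ne[of g h] g hD h(1) lt pD p by auto
        then have "col g = col p \<or> col h = col p" by linarith
        then show ?thesis using g hD \<open>g \<noteq> e\<close> \<open>h \<noteq> e\<close> by auto
      qed
    qed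
    have "matching D ends ?D0"
      unfolding matching_def
    proof (intro conjI ballI impI)
      fix g h assume gh: "g \<in> ?D0" "h \<in> ?D0" "g \<noteq> h"
      then show "ends g \<inter> ends h = {}" using ne[of g h] by auto
    qed auto
    then have "card (\<Union>(ends ` D) - {y}) = 2 * card ?D0"
      using card_covered[OF G, of ?D0] unfolding cov by blast
    moreover have "y \<in> \<Union>(ends ` D)" "finite (\<Union>(ends ` D))"
      using pD multigraphD(1)[OF G] by auto
    ultimately have "card (\<Union>(ends ` D)) = Suc (2 * card ?D0)" using card.remove[of "\<Union>(ends ` D)" y] by metis
    then show False using even_regular_card[OF fD c2 reg] assms(4) by simp
  qed
  have nb: "col g = col p" if g: "g \<in> D" "g \<noteq> e" "ends g \<inter> ends e \<noteq> {}" for g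
  proof -
    have "g \<in> {g\<in>D. x \<in> ends g} \<or> g \<in> {g\<in>D. y \<in> ends g}" using g xy by auto
    then show ?thesis using p q g eq by auto
  qed
  \<comment> \<open>Colours are 0 and 1, so the new value is the one that \<open>p\<close> and
    \<open>q\<close> do not use.\<close>
  have "proper ends 2 D (col(e := 1 - col p))"
    unfolding proper_def
  proof (intro conjI ballI impI)
    fix g assume "g \<in> D"
    then show "(col(e := 1 - col p)) g < 2" using lt by auto
  next
    fix g h assume "g \<in> D" "h \<in> D" "g \<noteq> h \<and> ends g \<inter> ends h \<noteq> {}"
    moreover have "1 - col p \<noteq> col p" by arith
    ultimately show "(col(e := 1 - col p)) g \<noteq> (col(e := 1 - col p)) h"
      using ne[of g h] nb[of g] nb[of h, unfolded Int_commute[of "ends h"]]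
      by (cases "g = e"; cases "h = e") simp_all
  qed
  then show ?thesis by blast
qed

lemma proper_disjoint_Un:
  assumes "proper ends k A col" "proper ends k B col'"
    and "\<And>e f. e \<in> A \<Longrightarrow> f \<in> B \<Longrightarrow> ends e \<inter> ends f = {}" "A \<inter> B = {}"
  shows "\<exists>col. proper ends k (A \<union> B) col"
proof -
  have "proper ends k (A \<union> B) (\<lambda>e. if e \<in> A then col e else col' e)"
    using assms unfolding proper_def by (auto simp: disjoint_iff) metis+
  then show ?thesis by blast
qed

text \<open>Cycles are peeled off one at a time, each as a minimal nonempty
  \<open>even_regular\<close> set D. By minimality, D without one edge is coloured as a forest. An
  even D gets this edge back; an odd D gives it up, paid for by the at least five edges of D that
  leave F.\<close>

lemma two_colorable_up_to_odd_cycles: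
  assumes "finite F" "\<And>e. e \<in> F \<Longrightarrow> card (ends e) = 2" "\<And>v. degree F ends v \<le> 2"
    and "\<And>D. D \<subseteq> F \<Longrightarrow> even_regular ends D \<Longrightarrow> odd (card D) \<Longrightarrow> 5 \<le> card D"
  shows "\<exists>R col. R \<subseteq> F \<and> proper ends 2 (F - R) col \<and> 5 * card R \<le> card F"
  using assms
proof (induction "card F" arbitrary: F rule: less_induct)
  case less
  note fF = less.prems(1)
  show ?case
  proof (cases "\<exists>D. D \<noteq> {} \<and> D \<subseteq> F \<and> even_regular ends D")
    case False
    then have "\<exists>col. proper ends 2 F col"
      using forest_two_colorable[of F ends] less.prems by blast
    then show ?thesis by (intro exI[of _ "{}"]) auto
  next
    case True
    then obtain D where D: "D \<noteq> {} \<and> D \<subseteq> F \<and> even_regular ends D"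
      and min: "\<And>D'. D' \<noteq> {} \<and> D' \<subseteq> F \<and> even_regular ends D' \<Longrightarrow> card D \<le> card D'"
      using ex_has_least_nat[of "\<lambda>D. D \<noteq> {} \<and> D \<subseteq> F \<and> even_regular ends D" _ card] by metis
    then obtain e where e: "e \<in> D" by blast
    have fD: "finite D" using D fF by (auto intro: finite_subset)
    have c2D: "\<And>g. g \<in> D \<Longrightarrow> card (ends g) = 2" using D less.prems(2) by auto
    have sm: "card (F - D) < card F" using D fF by (intro psubset_card_mono) auto
    have deg: "degree F' ends v \<le> 2" if "F' \<subseteq> F" for F' v
      using degree_mono[of F F' ends v] fF less.prems(3)[of v] that by linarith
    have "\<exists>R col. R \<subseteq> F - D \<and> proper ends 2 (F - D - R) col \<and> 5 * card R \<le> card (F - D)"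
      by (rule less.hyps[OF sm]) (use less.prems(1,2,4) deg in \<open>auto dest: subset_trans[OF _ Diff_subset]\<close>)
    then obtain R col where R: "R \<subseteq> F - D" "proper ends 2 (F - D - R) col" "5 * card R \<le> card (F - D)"
      by blast
    have DF: "D - {e} \<subseteq> F" using D by auto
    have "\<exists>col. proper ends 2 (D - {e}) col"
    proof (rule forest_two_colorable)
      fix D' assume D': "D' \<subseteq> D - {e}" "even_regular ends D'"
      show "D' = {}"
      proof (rule ccontr)
        assume "D' \<noteq> {}"
        then have "card D \<le> card D'" using min D D' by auto
        moreover have "card D' < card D" using D' e fD by (intro psubset_card_mono) auto
        ultimately show False by simp
      qed
    qed (use fD c2D deg[OF DF] in auto)
    then obtain colD where colD: "proper ends 2 (D - {e}) colD" by blast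
    have sep: "ends g \<inter> ends h = {}" if "g \<in> D" "h \<in> F - D" for g h
    proof (rule ccontr)
      assume "ends g \<inter> ends h \<noteq> {}"
      then obtain v where v: "v \<in> ends g" "v \<in> ends h" by blast
      then have "degree D ends v \<noteq> 0" using fD that by (auto simp: degree_0_iff)
      then have "degree D ends v = 2" using D by (metis even_regular_def)
      moreover have "degree D ends v < degree F ends v"
        unfolding degree_def using fF v that D by (intro psubset_card_mono) auto
      ultimately show False using less.prems(3)[of v] by simp
    qed
    have cF: "card F = card D + card (F - D)" using D fF by (metis card_Un_disjoint Diff_disjoint Diff_partition finite_Diff fD)
    show ?thesis
    proof (cases "even (card D)")
      case True
      then obtain c where "proper ends 2 D c"
        using proper_close_even_cycle[OF fD c2D _ _ e colD] D by auto
      then have "\<exists>c. proper ends 2 (D \<union> (F - D - R)) c"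
        using R(2) sep by (rule proper_disjoint_Un) auto
      moreover have "D \<union> (F - D - R) = F - R" using D R by auto
      ultimately show ?thesis using R cF by (intro exI[of _ R]) auto
    next
      case False
      then have "5 \<le> card D" using less.prems(4) D by auto
      moreover have "card (insert e R) \<le> Suc (card R)" by (rule card_insert_le_m1) auto
      ultimately have "5 * card (insert e R) \<le> card F" using cF R(3) by linarith
      moreover have "\<exists>c. proper ends 2 ((D - {e}) \<union> (F - D - R)) c"
        using colD R(2) by (rule proper_disjoint_Un) (use sep in auto)
      moreover have "(D - {e}) \<union> (F - D - R) = F - insert e R" using D R e by auto
      ultimately show ?thesis using R D e by (intro exI[of _ "insert e R"]) auto
    qed
  qed
qed

section \<open>Local structure, deletion counts and the setting of the induction\<close>

text \<open>
  The case x = y is a digon. Treating digons and triangles alike makes the property stable under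
  contraction of a triangle, which turns an adjacent triangle into a digon.
\<close>

definition near_triangle :: "'e set \<Rightarrow> ('e \<Rightarrow> 'v set) \<Rightarrow> 'v \<Rightarrow> bool" where
  "near_triangle E ends v \<longleftrightarrow> (\<exists>h1\<in>E. \<exists>h2\<in>E. \<exists>x y. h1 \<noteq> h2 \<and> ends h1 = {v, x} \<and> ends h2 = {v, y} \<and>
     (x = y \<or> (\<exists>h3\<in>E. ends h3 = {x, y})))"

lemma near_triangleE:
  assumes "near_triangle E ends v"
  obtains h1 h2 x y where "h1 \<in> E" "h2 \<in> E" "h1 \<noteq> h2" "ends h1 = {v, x}" "ends h2 = {v, y}"
    "x = y \<or> (\<exists>h3\<in>E. ends h3 = {x, y})"
  using assms unfolding near_triangle_def by (elim bexE exE conjE) (rule that)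

text \<open>Only the number of deleted edges matters to the induction: every reduction lifts a
  colouring with the same number.\<close>

definition colorable_deleting :: "'e set \<Rightarrow> ('e \<Rightarrow> 'v set) \<Rightarrow> nat \<Rightarrow> bool" where
  "colorable_deleting E ends k \<longleftrightarrow> (\<exists>R col. R \<subseteq> E \<and> proper ends 3 (E - R) col \<and> card R = k)"

lemma third_element:
  assumes "card A = 3" "x \<in> A" "y \<in> A" "x \<noteq> y"
  obtains z where "A = {x, y, z}" "z \<noteq> x" "z \<noteq> y"
proof -
  have fA: "finite A" using assms(1) by (intro card_ge_0_finite) simp
  then have "card (A - {x}) = 2" using assms by simp
  then obtain z where "A - {x} = {y, z}" "z \<noteq> y" using other_end[of "A - {x}" y] assms by auto
  then have "A = {x, y, z}" "z \<noteq> x" "z \<noteq> y" using assms(2) by auto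
  then show ?thesis by (rule that)
qed

lemma ex_third_color: "\<exists>p<3. p \<noteq> s \<and> p \<noteq> (t::nat)"
proof -
  have "\<not> {0, 1, 2} \<subseteq> {s, t}"
  proof
    assume "{0, 1, 2} \<subseteq> {s, t}"
    then have "card {0, 1, 2::nat} \<le> card {s, t}" by (intro card_mono) auto
    also have "\<dots> \<le> 2" by (simp add: card_insert_if)
    finally show False by simp
  qed
  then obtain p where "p \<in> {0, 1, 2}" "p \<notin> {s, t}" by blast
  then show ?thesis by (intro exI[of _ p]) auto
qed

locale cubic_graph =
  fixes V :: "'v set" and E :: "'e set" and ends :: "'e \<Rightarrow> 'v set"
  assumes graph: "multigraph V E ends" and cubic: "cubic V E ends"
    and bridge_cut_free: "bridge_cut_free V E ends"
begin

lemmas finite_V = multigraphD(1)[OF graph] and finite_E = multigraphD(2)[OF graph]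
  and ends_sub = multigraphD(3)[OF graph] and card_ends = multigraphD(4)[OF graph]

lemma three_edges: "v \<in> V \<Longrightarrow> card {e\<in>E. v \<in> ends e} = 3"
  using cubic by (simp add: cubic_def degree_def)

lemma ends_at:
  assumes "e \<in> E" "v \<in> ends e"
  obtains u where "ends e = {v, u}" "u \<noteq> v" "u \<in> V"
proof -
  obtain u where "ends e = {v, u}" "u \<noteq> v" using other_end[OF card_ends[OF assms(1)] assms(2)] .
  then show ?thesis using that ends_sub[OF assms(1)] by auto
qed

end

section \<open>Reductions\<close>

locale triple_edge = cubic_graph +
  fixes a b e1 e2 f
  assumes inc_a: "{e\<in>E. a \<in> ends e} = {e1, e2, f}" and inc_b: "{e\<in>E. b \<in> ends e} = {e1, e2, f}"
    and e_distinct: "distinct [e1, e2, f]" and ab: "a \<noteq> b" "a \<in> V" "b \<in> V"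
begin

abbreviation "V' \<equiv> V - {a, b}"
abbreviation "E' \<equiv> E - {e1, e2, f}"

lemma in_E: "e1 \<in> E" "e2 \<in> E" "f \<in> E"
  using inc_a by blast+

lemma deleted_ends: "e \<in> {e1, e2, f} \<Longrightarrow> ends e = {a, b}"
proof -
  assume e: "e \<in> {e1, e2, f}"
  then have "e \<in> {e\<in>E. a \<in> ends e}" "e \<in> {e\<in>E. b \<in> ends e}" by (simp_all only: inc_a inc_b)
  then have "e \<in> E" "a \<in> ends e" "b \<in> ends e" by auto
  then show ?thesis using ends_at[of e a] ab by (metis doubleton_eq_iff insertE singletonD)
qed

lemma kept_ends: "e \<in> E' \<Longrightarrow> a \<notin> ends e \<and> b \<notin> ends e"
  using inc_a inc_b by blast

lemma reduced: "cubic_graph V' E' ends"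
proof
  show "multigraph V' E' ends"
    using graph kept_ends by (auto simp: multigraph_def)
  have "{e\<in>E'. v \<in> ends e} = {e\<in>E. v \<in> ends e}" if "v \<in> V'" for v
    using deleted_ends that by auto
  then show "cubic V' E' ends" using cubic by (simp add: cubic_def degree_def)
  show "bridge_cut_free V' E' ends"
    unfolding bridge_cut_free_def
  proof (intro allI impI)
    fix X assume X: "X \<subseteq> V'"
    then have "cut E' ends X = cut E ends X" using deleted_ends by (auto simp: cut_def)
    then show "card (cut E' ends X) \<noteq> 1" using bridge_cut_free X by (auto simp: bridge_cut_free_def)
  qed
qed

lemma near_triangle_reduced:
  assumes "v \<in> V'" "near_triangle E ends v"
  shows "near_triangle E' ends v"
proof -
  obtain h1 h2 x y where h: "h1 \<in> E" "h2 \<in> E" "h1 \<noteq> h2" "ends h1 = {v, x}" "ends h2 = {v, y}"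
    "x = y \<or> (\<exists>h3\<in>E. ends h3 = {x, y})" using assms(2) by (rule near_triangleE)
  have h': "h1 \<in> E'" "h2 \<in> E'" using h deleted_ends assms(1) by blast+
  then have "{x, y} \<inter> {a, b} = {}" using kept_ends[OF h'(1)] kept_ends[OF h'(2)] h(4,5) by simp
  moreover have "ends k \<inter> {a, b} \<noteq> {}" if "k \<in> {e1, e2, f}" for k
    using deleted_ends[OF that] by simp
  ultimately have "x = y \<or> (\<exists>h3\<in>E'. ends h3 = {x, y})" using h(6) by (metis DiffI)
  then show ?thesis unfolding near_triangle_def using h(3-5) h' by blast
qed

text \<open>The two vertices form a component of their own, so their three edges take the three
  colours whatever happens elsewhere.\<close>

lemma colorable_lift:
  assumes "colorable_deleting E' ends k"
  shows "colorable_deleting E ends k"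
proof -
  obtain R col where R: "R \<subseteq> E'" "proper ends 3 (E' - R) col" "card R = k"
    using assms by (auto simp: colorable_deleting_def)
  have "proper ends 3 {e1, e2, f} (\<lambda>e. if e = e1 then 0 else if e = e2 then 1 else 2)"
    using e_distinct by (auto simp: proper_def)
  then have "\<exists>c. proper ends 3 ({e1, e2, f} \<union> (E' - R)) c"
    by (rule proper_disjoint_Un[OF _ R(2)]) (use deleted_ends kept_ends in auto)
  moreover have "{e1, e2, f} \<union> (E' - R) = E - R" using R(1) in_E by auto
  ultimately show ?thesis using R unfolding colorable_deleting_def by auto
qed

end

section \<open>Suppressing a digon\<close>

locale digon = cubic_graph +
  fixes a b u w e1 e2 f g
  assumes inc_a: "{e\<in>E. a \<in> ends e} = {e1, e2, f}" and inc_b: "{e\<in>E. b \<in> ends e} = {e1, e2, g}"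
    and ends_e: "ends e1 = {a, b}" "ends e2 = {a, b}" "ends f = {a, u}" "ends g = {b, w}"
    and e_distinct: "distinct [e1, e2, f, g]" and v_distinct: "distinct [a, b, u, w]"
    and in_V: "a \<in> V" "b \<in> V" "u \<in> V" "w \<in> V"
begin

abbreviation "V' \<equiv> V - {a, b}"
abbreviation "E' \<equiv> E - {e1, e2, g}"
text \<open>The edge \<open>f\<close> survives with its end \<open>a\<close> moved to
  \<open>w\<close> and stands for the connection from \<open>u\<close> to \<open>w\<close> through
  the digon; \<open>g\<close> is dropped. No new element of the edge type is needed.\<close>

abbreviation "ends' \<equiv> ends(f := {u, w})"

lemma in_E: "e1 \<in> E" "e2 \<in> E" "f \<in> E" "g \<in> E"
  using inc_a inc_b by blast+

lemma kept_ends: "e \<in> E' \<Longrightarrow> e \<noteq> f \<Longrightarrow> a \<notin> ends e \<and> b \<notin> ends e"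
  using inc_a inc_b by blast

lemma reduced: "cubic_graph V' E' ends'"
proof
  have "ends' e \<subseteq> V' \<and> card (ends' e) = 2" if "e \<in> E'" for e
    using that graph kept_ends[OF that] in_V v_distinct by (auto simp: multigraph_def)
  then show "multigraph V' E' ends'"
    using finite_V finite_E by (auto simp: multigraph_def)
  have "card {e\<in>E'. v \<in> ends' e} = 3" if v: "v \<in> V'" for v
  proof (cases "v = w")
    case True
    have "{e\<in>E'. v \<in> ends' e} = insert f ({e\<in>E. v \<in> ends e} - {g})"
      using True ends_e v_distinct e_distinct in_E by auto
    moreover have "f \<notin> {e\<in>E. v \<in> ends e} - {g}" using True ends_e v_distinct by auto
    moreover have "g \<in> {e\<in>E. v \<in> ends e}" using True ends_e in_E by auto
    ultimately show ?thesis using three_edges[of v] v finite_E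
      by (simp add: card_Diff_singleton)
  next
    case False
    have "{e\<in>E'. v \<in> ends' e} = {e\<in>E. v \<in> ends e}"
      using False v ends_e v_distinct e_distinct in_E by auto
    then show ?thesis using three_edges[of v] v by simp
  qed
  then show "cubic V' E' ends'" by (simp add: cubic_def degree_def)
  show "bridge_cut_free V' E' ends'"
    unfolding bridge_cut_free_def
  proof (intro allI impI)
    fix X assume X: "X \<subseteq> V'"
    \<comment> \<open>The digon is put on the side of \<open>u\<close>. Then, of the edges at
      \<open>a\<close> and \<open>b\<close>, only \<open>g\<close> can be cut, and it is cut exactly
      when the redirected \<open>f\<close> is.\<close>
    let ?Y = "if u \<in> X then insert a (insert b X) else X"
    let ?C = "cut E' ends' X"
    have aX: "a \<notin> X" "b \<notin> X" using X by auto
    have YV: "?Y \<subseteq> V" using X in_V by auto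
    have oth: "e \<in> cut E ends ?Y \<longleftrightarrow> e \<in> ?C" if "e \<notin> {e1, e2, f, g}" for e
      using that kept_ends[of e] by (auto simp: cut_def)
    have sp: "e1 \<notin> cut E ends ?Y" "e2 \<notin> cut E ends ?Y" "f \<notin> cut E ends ?Y"
      "e1 \<notin> ?C" "e2 \<notin> ?C" "g \<notin> ?C"
      using aX ends_e by (auto simp: cut_def)
    have fg: "g \<in> cut E ends ?Y \<longleftrightarrow> f \<in> ?C"
      using aX ends_e in_E e_distinct v_distinct by (auto simp: cut_def)
    have "card (cut E ends ?Y) = card ?C"
    proof (cases "f \<in> ?C")
      case True
      have eq: "cut E ends ?Y = insert g (?C - {f})"
      proof (rule set_eqI)
        fix e show "e \<in> cut E ends ?Y \<longleftrightarrow> e \<in> insert g (?C - {f})"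
          using oth[of e] sp fg True by (cases "e \<in> {e1, e2, f, g}") blast+
      qed
      have "finite ?C" using finite_E by (simp add: cut_def)
      then have "card ?C = Suc (card (?C - {f}))" using True by (rule card.remove)
      moreover have "card (insert g (?C - {f})) = Suc (card (?C - {f}))"
        using \<open>finite ?C\<close> sp by (intro card_insert_disjoint) auto
      ultimately show ?thesis by (simp only: eq)
    next
      case False
      have "cut E ends ?Y = ?C"
      proof (rule set_eqI)
        fix e show "e \<in> cut E ends ?Y \<longleftrightarrow> e \<in> ?C"
          using oth[of e] sp fg False by (cases "e \<in> {e1, e2, f, g}") blast+
      qed
      then show ?thesis by simp
    qed
    then show "card ?C \<noteq> 1" using bridge_cut_free YV unfolding bridge_cut_free_def by metis
  qed
qed

text \<open>A triangle or digon at v avoids both \<open>a\<close> and \<open>b\<close>: the only way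
  from \<open>a\<close> other than to \<open>b\<close> is \<open>f\<close> to \<open>u\<close>, the
  only way from \<open>b\<close> other than to \<open>a\<close> is \<open>g\<close> to
  \<open>w\<close>, and \<open>u\<close> and \<open>w\<close> are distinct. All its edges are
  therefore kept with unchanged ends.\<close>

lemma near_triangle_reduced:
  assumes v: "v \<in> V'" and "near_triangle E ends v"
  shows "near_triangle E' ends' v"
proof -
  obtain h1 h2 x y where h: "h1 \<in> E" "h2 \<in> E" "h1 \<noteq> h2" "ends h1 = {v, x}" "ends h2 = {v, y}"
    "x = y \<or> (\<exists>h3\<in>E. ends h3 = {x, y})" using assms(2) by (rule near_triangleE)
  have va: "v \<noteq> a" "v \<noteq> b" using v by auto
  have at_a: "h = f \<and> z = u" if "h \<in> E" "ends h = {a, z}" "z \<noteq> b" for h z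
  proof -
    have "h \<in> {e1, e2, f}" using that inc_a by blast
    then show ?thesis using that ends_e by (auto simp: doubleton_eq_iff)
  qed
  have at_b: "h = g \<and> z = w" if "h \<in> E" "ends h = {b, z}" "z \<noteq> a" for h z
  proof -
    have "h \<in> {e1, e2, g}" using that inc_b by blast
    then show ?thesis using that ends_e by (auto simp: doubleton_eq_iff)
  qed
  have avoid: False if kk: "k1 \<in> E" "k2 \<in> E" "k1 \<noteq> k2" "ends k1 = {v, p}" "ends k2 = {v, q}"
    "p = q \<or> (\<exists>h3\<in>E. ends h3 = {p, q})" "p = a \<or> p = b" for k1 k2 p q
  proof -
    have qv: "q \<noteq> v" using card_ends[OF kk(2)] kk(5) by auto
    consider "p = a" | "p = b" using kk(7) by blast
    then show False
    proof cases
      case 1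
      then have "k1 = f" "v = u" using at_a[of k1 v] kk va by (auto simp: insert_commute)
      moreover have "q \<noteq> a" using at_a[of k2 v] kk va calculation by (auto simp: insert_commute)
      moreover have "q \<noteq> b" using at_b[of k2 v] kk va calculation v_distinct by (auto simp: insert_commute)
      ultimately show False using kk(6) 1 at_a[of _ q] qv by auto
    next
      case 2
      then have "k1 = g" "v = w" using at_b[of k1 v] kk va by (auto simp: insert_commute)
      moreover have "q \<noteq> b" using at_b[of k2 v] kk va calculation by (auto simp: insert_commute)
      moreover have "q \<noteq> a" using at_a[of k2 v] kk va calculation v_distinct by (auto simp: insert_commute)
      ultimately show False using kk(6) 2 at_b[of _ q] qv by auto
    qed
  qed
  have "x \<noteq> a" "x \<noteq> b" using avoid[OF h(1-6)] by blast+
  moreover have "y = x \<or> (\<exists>h3\<in>E. ends h3 = {y, x})" using h(6) by (auto simp: insert_commute)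
  then have "y \<noteq> a" "y \<noteq> b" using avoid[OF h(2,1) h(3)[symmetric] h(5,4)] by blast+
  ultimately have xy: "{v, x, y} \<inter> {a, b} = {}" using va by auto
  have keep: "k \<in> E' \<and> ends' k = ends k" if "k \<in> E" "ends k \<subseteq> {v, x, y}" for k
  proof -
    have "k \<notin> {e1, e2, f, g}" using that xy ends_e by auto
    then show ?thesis using that by auto
  qed
  have "h1 \<in> E' \<and> ends' h1 = ends h1" "h2 \<in> E' \<and> ends' h2 = ends h2" using keep h by auto
  moreover have "x = y \<or> (\<exists>h3\<in>E'. ends' h3 = {x, y})"
    using h(6) keep by (metis insertI1 insert_subset subset_insertI)
  ultimately show ?thesis using h unfolding near_triangle_def by metis
qed

text \<open>If \<open>f\<close> is coloured, \<open>g\<close> copies its colour; if \<open>f\<close>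
  is deleted, it stays deleted and \<open>g\<close> takes a colour free at \<open>w\<close>. In both
  cases the digon edges take the two other colours, so the deleted set is unchanged.\<close>

lemma colorable_lift:
  assumes "colorable_deleting E' ends' k"
  shows "colorable_deleting E ends k"
proof -
  obtain R col where R: "R \<subseteq> E'" "proper ends' 3 (E' - R) col" "card R = k"
    using assms by (auto simp: colorable_deleting_def)
  have lt: "\<And>h. h \<in> E' - R \<Longrightarrow> col h < 3" using R by (auto simp: proper_def)
  have ne: "col h \<noteq> col h'" if "h \<in> E' - R" "h' \<in> E' - R" "h \<noteq> h'" "ends' h \<inter> ends' h' \<noteq> {}" for h h'
    using R(2) that unfolding proper_def by blast
  have "\<exists>c<3. (f \<notin> R \<longrightarrow> c = col f) \<and> (\<forall>h\<in>E' - R. h \<noteq> f \<and> w \<in> ends h \<longrightarrow> col h \<noteq> c)"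
  proof (cases "f \<in> R")
    case False
    then have fE: "f \<in> E' - R" using in_E e_distinct by auto
    then show ?thesis using lt ne[OF _ fE] by (intro exI[of _ "col f"]) auto
  next
    case True
    have "card {e\<in>E. w \<in> ends e} = 3" by (rule three_edges[OF in_V(4)])
    moreover have "g \<in> {e\<in>E. w \<in> ends e}" using in_E ends_e by auto
    ultimately have "card ({e\<in>E. w \<in> ends e} - {g}) = 2" using finite_E by simp
    then obtain p q where pq: "{e\<in>E. w \<in> ends e} - {g} = {p, q}" by (auto simp: card_2_iff)
    obtain c where "c < 3" "c \<noteq> col p" "c \<noteq> col q" using ex_third_color by blast
    moreover have "h \<in> {p, q}" if "h \<in> E' - R" "w \<in> ends h" for h using that pq by blast
    ultimately show ?thesis using True by (intro exI[of _ c]) auto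
  qed
  then obtain c where c: "c < 3" "f \<notin> R \<Longrightarrow> c = col f"
    "\<And>h. h \<in> E' - R \<Longrightarrow> h \<noteq> f \<Longrightarrow> w \<in> ends h \<Longrightarrow> col h \<noteq> c" by blast
  obtain d where d: "d < 3" "d \<noteq> c" using ex_third_color[of c c] by blast
  obtain d' where d': "d' < 3" "d' \<noteq> c" "d' \<noteq> d" using ex_third_color[of c d] by blast
  let ?col = "col(g := c, e1 := d, e2 := d')"
  have old: "?col h = col h" if "h \<in> E'" for h using that by auto
  have new: "?col g = c" "?col e1 = d" "?col e2 = d'" using e_distinct by auto
  have nf: "col h = c" if "h \<in> E' - R" "a \<in> ends h \<or> b \<in> ends h" for h
    using kept_ends[of h] that c by auto
  have gh: "?col g \<noteq> col h" if "h \<in> E' - R" "ends g \<inter> ends h \<noteq> {}" for h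
  proof -
    have "h \<noteq> f" using that ends_e v_distinct by auto
    moreover then have "w \<in> ends h" using that ends_e kept_ends[of h] by auto
    ultimately show ?thesis using c(3)[OF that(1)] new by auto
  qed
  have "proper ends 3 ((E' - R) \<union> {g, e1, e2}) ?col"
    unfolding proper_def
  proof (intro conjI ballI impI)
    fix h assume "h \<in> (E' - R) \<union> {g, e1, e2}"
    then show "?col h < 3" using lt new c d d' by auto
  next
    fix h h' assume hh: "h \<in> (E' - R) \<union> {g, e1, e2}" "h' \<in> (E' - R) \<union> {g, e1, e2}"
      "h \<noteq> h' \<and> ends h \<inter> ends h' \<noteq> {}"
    have oo: "?col k \<noteq> ?col k'" if k: "k \<in> E' - R" "k' \<in> E' - R" "k \<noteq> k'" "ends k \<inter> ends k' \<noteq> {}" for k k'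
    proof -
      have "ends' k \<inter> ends' k' \<noteq> {}" using k ends_e kept_ends[of k] kept_ends[of k'] by auto
      then show ?thesis using ne[OF k(1,2,3)] k old by auto
    qed
    have no: "?col k \<noteq> ?col k'" if k: "k \<in> {g, e1, e2}" "k' \<in> E' - R" "ends k \<inter> ends k' \<noteq> {}" for k k'
    proof (cases "k = g")
      case True
      then show ?thesis using gh[OF k(2)] k old by simp
    next
      case False
      then have "a \<in> ends k' \<or> b \<in> ends k'" using k ends_e by auto
      then have "col k' = c" using nf k by auto
      then show ?thesis using False k old new d d' by auto
    qed
    have nn: "?col k \<noteq> ?col k'" if "k \<in> {g, e1, e2}" "k' \<in> {g, e1, e2}" "k \<noteq> k'" for k k'
      using that new d d' by auto
    show "?col h \<noteq> ?col h'"
    proof (cases "h \<in> E' - R")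
      case True
      then show ?thesis using oo[of h h'] no[of h' h, symmetric] hh by (cases "h' \<in> E' - R") (auto simp del: fun_upd_apply)
    next
      case False
      then show ?thesis using nn[of h h'] no[of h h'] hh by (cases "h' \<in> E' - R") (auto simp del: fun_upd_apply)
    qed
  qed
  moreover have "(E' - R) \<union> {g, e1, e2} = E - R" using R(1) in_E by auto
  ultimately show ?thesis using R unfolding colorable_deleting_def by auto
qed

end

section \<open>Contracting a triangle\<close>

lemma complete_partial_coloring:
  fixes p q r :: nat
  assumes "\<alpha> \<Longrightarrow> p < 3" "\<beta> \<Longrightarrow> q < 3" "\<gamma> \<Longrightarrow> r < 3"
    and "\<alpha> \<Longrightarrow> \<beta> \<Longrightarrow> p \<noteq> q" "\<alpha> \<Longrightarrow> \<gamma> \<Longrightarrow> p \<noteq> r" "\<beta> \<Longrightarrow> \<gamma> \<Longrightarrow> q \<noteq> r"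
  shows "\<exists>p' q' r'. p' < 3 \<and> q' < 3 \<and> r' < 3 \<and> p' \<noteq> q' \<and> p' \<noteq> r' \<and> q' \<noteq> r' \<and>
    (\<alpha> \<longrightarrow> p' = p) \<and> (\<beta> \<longrightarrow> q' = q) \<and> (\<gamma> \<longrightarrow> r' = r)"
proof -
  \<comment> \<open>The conditions tell which values are already fixed; in the application, that an
    edge leaving the triangle has not been deleted. Each value avoids those chosen before it and
    those fixed after it, at most two in all.\<close>
  obtain p' where p': "p' < 3" "\<alpha> \<Longrightarrow> p' = p" "\<beta> \<Longrightarrow> p' \<noteq> q" "\<gamma> \<Longrightarrow> p' \<noteq> r"
    using assms ex_third_color[of q r] by (cases \<alpha>) auto
  obtain q' where q': "q' < 3" "q' \<noteq> p'" "\<beta> \<Longrightarrow> q' = q" "\<gamma> \<Longrightarrow> q' \<noteq> r"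
    using assms p' ex_third_color[of p' r] by (cases \<beta>) auto
  obtain r' where "r' < 3" "r' \<noteq> p'" "r' \<noteq> q'" "\<gamma> \<Longrightarrow> r' = r"
    using assms p' q' ex_third_color[of p' q'] by (cases \<gamma>) auto
  then show ?thesis using p' q' by (intro exI[of _ p'] exI[of _ q'] exI[of _ r']) auto
qed

lemma in_not_empty: "x \<in> A \<Longrightarrow> A \<noteq> {}"
  by blast

locale triangle = cubic_graph +
  fixes a b c e1 e2 e3 fa fb fc
  assumes inc_a: "{e\<in>E. a \<in> ends e} = {e1, e3, fa}" and inc_b: "{e\<in>E. b \<in> ends e} = {e1, e2, fb}"
    and inc_c: "{e\<in>E. c \<in> ends e} = {e2, e3, fc}"
    and ends_e: "ends e1 = {a, b}" "ends e2 = {b, c}" "ends e3 = {a, c}"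
    and e_distinct: "distinct [e1, e2, e3, fa, fb, fc]" and v_distinct: "distinct [a, b, c]"
    and in_V: "a \<in> V" "b \<in> V" "c \<in> V"
begin

abbreviation "V' \<equiv> V - {b, c}"
abbreviation "E' \<equiv> E - {e1, e2, e3}"
text \<open>The corner \<open>a\<close> doubles as the contracted vertex, so the new vertex set is a
  subset of the old one and edges keep their identity.\<close>

abbreviation \<phi> where "\<phi> \<equiv> \<lambda>v. if v = b \<or> v = c then a else v"
abbreviation "ends' \<equiv> \<lambda>e. \<phi> ` ends e"

lemma in_E: "e1 \<in> E" "e2 \<in> E" "e3 \<in> E" "fa \<in> E" "fb \<in> E" "fc \<in> E"
  using inc_a inc_b inc_c by blast+

lemma kept_at_corner:
  assumes "e \<in> E'"
  shows "a \<in> ends e \<longleftrightarrow> e = fa" "b \<in> ends e \<longleftrightarrow> e = fb" "c \<in> ends e \<longleftrightarrow> e = fc"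
  using assms inc_a inc_b inc_c by blast+

lemma in_contracted:
  "v \<in> ends' e \<longleftrightarrow> (if v = a then a \<in> ends e \<or> b \<in> ends e \<or> c \<in> ends e else v \<noteq> b \<and> v \<noteq> c \<and> v \<in> ends e)"
  using v_distinct by (auto simp: image_iff)

lemma reduced: "cubic_graph V' E' ends'"
proof
  have "ends' e \<subseteq> V' \<and> card (ends' e) = 2" if e: "e \<in> E'" for e
  proof
    show "ends' e \<subseteq> V'" using e ends_sub[of e] in_V v_distinct by auto
    \<comment> \<open>No kept edge joins two corners, because \<open>fa\<close>, \<open>fb\<close>
      and \<open>fc\<close> are distinct; so contraction creates no loop.\<close>
    have "inj_on \<phi> (ends e)"
      using kept_at_corner[OF e] e_distinct by (intro inj_onI) (auto split: if_splits)
    then have "card (ends' e) = card (ends e)" by (rule card_image)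
    then show "card (ends' e) = 2" using e card_ends[of e] by (simp only: Diff_iff)
  qed
  then show "multigraph V' E' ends'"
    using finite_V finite_E by (auto simp: multigraph_def)
  have "card {e\<in>E'. v \<in> ends' e} = 3" if v: "v \<in> V'" for v
  proof (cases "v = a")
    case True
    have "{e\<in>E'. v \<in> ends' e} = {fa, fb, fc}"
    proof (rule set_eqI)
      fix e show "e \<in> {e\<in>E'. v \<in> ends' e} \<longleftrightarrow> e \<in> {fa, fb, fc}"
      proof (cases "e \<in> E'")
        case e: True
        show ?thesis using e True unfolding in_contracted kept_at_corner[OF e] mem_Collect_eq by simp
      next
        case False
        moreover have "{fa, fb, fc} \<subseteq> E'" using in_E e_distinct by auto
        ultimately show ?thesis by blast
      qed
    qed
    then show ?thesis using e_distinct by simp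
  next
    case False
    have "{e\<in>E'. v \<in> ends' e} = {e\<in>E. v \<in> ends e}"
      unfolding in_contracted using False v ends_e by auto
    then show ?thesis using three_edges[of v] v by simp
  qed
  then show "cubic V' E' ends'" by (simp add: cubic_def degree_def)
  show "bridge_cut_free V' E' ends'"
    unfolding bridge_cut_free_def
  proof (intro allI impI)
    fix X assume X: "X \<subseteq> V'"
    \<comment> \<open>The preimage puts the three corners on one side, so no triangle edge is cut,
      and all other edges are cut alike in both graphs.\<close>
    let ?Y = "\<phi> -` X"
    have "?Y \<subseteq> V" using X in_V by (auto split: if_splits)
    moreover have "cut E' ends' X = cut E ends ?Y"
    proof (rule set_eqI)
      fix e
      have "ends' e \<inter> X \<noteq> {} \<longleftrightarrow> ends e \<inter> ?Y \<noteq> {}" "ends' e \<subseteq> X \<longleftrightarrow> ends e \<subseteq> ?Y" by blast+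
      moreover have "ends e \<subseteq> ?Y \<or> ends e \<inter> ?Y = {}" if "e \<in> {e1, e2, e3}"
        using that ends_e v_distinct by auto
      ultimately show "e \<in> cut E' ends' X \<longleftrightarrow> e \<in> cut E ends ?Y" unfolding cut_def by blast
    qed
    ultimately show "card (cut E' ends' X) \<noteq> 1"
      using bridge_cut_free unfolding bridge_cut_free_def by metis
  qed
qed

text \<open>A digon at v stays a digon; a triangle at v survives, or becomes a digon if its two
  other vertices are merged. The contracted vertex is excluded, since it may lie on no triangle or
  digon any more.\<close>

lemma near_triangle_reduced:
  assumes v: "v \<in> V'" "v \<noteq> a" and "near_triangle E ends v"
  shows "near_triangle E' ends' v"
proof -
  obtain h1 h2 x y where h: "h1 \<in> E" "h2 \<in> E" "h1 \<noteq> h2" "ends h1 = {v, x}" "ends h2 = {v, y}"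
    "x = y \<or> (\<exists>h3\<in>E. ends h3 = {x, y})" using assms(3) by (rule near_triangleE)
  have v_kept: "k \<in> E'" if "k \<in> E" "v \<in> ends k" for k using that v ends_e by auto
  have "h1 \<in> E'" "h2 \<in> E'" using v_kept h by auto
  moreover have "ends' h1 = {v, \<phi> x}" "ends' h2 = {v, \<phi> y}" using h v by auto
  moreover have "\<phi> x = \<phi> y \<or> (\<exists>h3\<in>E'. ends' h3 = {\<phi> x, \<phi> y})"
  proof (cases "\<phi> x = \<phi> y")
    case False
    then obtain h3 where h3: "h3 \<in> E" "ends h3 = {x, y}" using h(6) by auto
    have "h3 \<notin> {e1, e2, e3}"
    proof
      assume "h3 \<in> {e1, e2, e3}"
      then have "{x, y} \<subseteq> {a, b, c}" using h3 ends_e by auto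
      then show False using False by auto
    qed
    moreover have "ends' h3 = {\<phi> x, \<phi> y}" using h3 by simp
    ultimately show ?thesis using h3 by blast
  qed simp
  ultimately show ?thesis using h(3) unfolding near_triangle_def by blast
qed

text \<open>At the contracted vertex the coloured ones among \<open>fa\<close>, \<open>fb\<close>,
  \<open>fc\<close> have distinct colours; deleted ones get nominal colours that complete the three.
  Each triangle edge then takes the colour belonging to the opposite corner.\<close>

lemma colorable_lift:
  assumes "colorable_deleting E' ends' k"
  shows "colorable_deleting E ends k"
proof -
  obtain R col where R: "R \<subseteq> E'" "proper ends' 3 (E' - R) col" "card R = k"
    using assms by (auto simp: colorable_deleting_def)
  have lt: "\<And>h. h \<in> E' - R \<Longrightarrow> col h < 3" using R by (auto simp: proper_def)
  have ne: "col h \<noteq> col h'" if "h \<in> E' - R" "h' \<in> E' - R" "h \<noteq> h'" "ends' h \<inter> ends' h' \<noteq> {}" for h h'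
    using R(2) that unfolding proper_def by blast
  have fE: "{fa, fb, fc} \<subseteq> E'" using in_E e_distinct by auto
  have "fa \<in> {e\<in>E. a \<in> ends e}" "fb \<in> {e\<in>E. b \<in> ends e}" "fc \<in> {e\<in>E. c \<in> ends e}"
    by (simp_all add: inc_a inc_b inc_c)
  then have a_in: "a \<in> ends' fa" "a \<in> ends' fb" "a \<in> ends' fc" by (auto simp: in_contracted)
  have f_ne: "col h \<noteq> col h'" if hh: "h \<in> {fa, fb, fc} - R" "h' \<in> {fa, fb, fc} - R" "h \<noteq> h'" for h h'
  proof (rule ne)
    have "a \<in> ends' h" "a \<in> ends' h'" using hh(1,2) a_in by (elim DiffE insertE emptyE; simp only:)+
    then have "a \<in> ends' h \<inter> ends' h'" by (rule IntI)
    then show "ends' h \<inter> ends' h' \<noteq> {}" by (rule in_not_empty)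
  qed (use hh fE in blast)+
  have "fa \<notin> R \<Longrightarrow> col fa < 3" "fb \<notin> R \<Longrightarrow> col fb < 3" "fc \<notin> R \<Longrightarrow> col fc < 3"
    using lt fE by auto
  moreover have "fa \<notin> R \<Longrightarrow> fb \<notin> R \<Longrightarrow> col fa \<noteq> col fb" "fa \<notin> R \<Longrightarrow> fc \<notin> R \<Longrightarrow> col fa \<noteq> col fc"
    "fb \<notin> R \<Longrightarrow> fc \<notin> R \<Longrightarrow> col fb \<noteq> col fc"
    using f_ne[of fa fb] f_ne[of fa fc] f_ne[of fb fc] e_distinct by simp_all
  ultimately have "\<exists>p q r. p < 3 \<and> q < 3 \<and> r < 3 \<and> p \<noteq> q \<and> p \<noteq> r \<and> q \<noteq> r \<and>
    (fa \<notin> R \<longrightarrow> p = col fa) \<and> (fb \<notin> R \<longrightarrow> q = col fb) \<and> (fc \<notin> R \<longrightarrow> r = col fc)"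
    by (rule complete_partial_coloring)
  then obtain p q r where pqr: "p < 3" "q < 3" "r < 3" "p \<noteq> q" "p \<noteq> r" "q \<noteq> r"
    "fa \<notin> R \<longrightarrow> p = col fa" "fb \<notin> R \<longrightarrow> q = col fb" "fc \<notin> R \<longrightarrow> r = col fc"
    by (elim exE conjE) (rule that)
  \<comment> \<open>\<open>e1\<close> lies opposite \<open>c\<close>, \<open>e2\<close> opposite
    \<open>a\<close> and \<open>e3\<close> opposite \<open>b\<close>.\<close>
  let ?col = "col(e1 := r, e2 := p, e3 := q)"
  have old: "?col h = col h" if "h \<in> E'" for h using that by auto
  have new: "?col e1 = r" "?col e2 = p" "?col e3 = q" using e_distinct by auto
  have oo: "?col h \<noteq> ?col h'" if hh: "h \<in> E' - R" "h' \<in> E' - R" "h \<noteq> h'" "ends h \<inter> ends h' \<noteq> {}" for h h'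
  proof -
    have "ends' h \<inter> ends' h' \<noteq> {}" using hh(4) by blast
    then have "col h \<noteq> col h'" using ne hh by blast
    then show ?thesis using old hh by auto
  qed
  have no: "?col h \<noteq> ?col h'" if hh: "h \<in> {e1, e2, e3}" "h' \<in> E' - R" "ends h \<inter> ends h' \<noteq> {}" for h h'
  proof -
    have h': "h' \<in> E'" "h' \<notin> R" using hh by auto
    note corner = kept_at_corner[OF h'(1)]
    have "h = e1 \<and> h' \<in> {fa, fb} \<or> h = e2 \<and> h' \<in> {fb, fc} \<or> h = e3 \<and> h' \<in> {fa, fc}"
      using hh(1,3) ends_e corner by auto
    then show ?thesis unfolding old[OF h'(1)] using new pqr h'(2) by auto
  qed
  have nn: "?col h \<noteq> ?col h'" if "h \<in> {e1, e2, e3}" "h' \<in> {e1, e2, e3}" "h \<noteq> h'" for h h'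
    using that new pqr by auto
  have "proper ends 3 ((E' - R) \<union> {e1, e2, e3}) ?col"
    unfolding proper_def
  proof (intro conjI ballI impI)
    fix h assume "h \<in> (E' - R) \<union> {e1, e2, e3}"
    then show "?col h < 3" using lt new pqr by auto
  next
    fix h h' assume hh: "h \<in> (E' - R) \<union> {e1, e2, e3}" "h' \<in> (E' - R) \<union> {e1, e2, e3}"
      "h \<noteq> h' \<and> ends h \<inter> ends h' \<noteq> {}"
    show "?col h \<noteq> ?col h'"
    proof (cases "h \<in> E' - R")
      case True
      then show ?thesis using oo[of h h'] no[of h' h, symmetric] hh by (cases "h' \<in> E' - R") (auto simp del: fun_upd_apply)
    next
      case False
      then show ?thesis using nn[of h h'] no[of h h'] hh by (cases "h' \<in> E' - R") (auto simp del: fun_upd_apply)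
    qed
  qed
  moreover have "(E' - R) \<union> {e1, e2, e3} = E - R" using R(1) in_E by auto
  ultimately show ?thesis using R unfolding colorable_deleting_def by auto
qed

end

section \<open>The bound\<close>

context cubic_graph
begin

text \<open>If the third edges at the two ends agree, the edge is triple. Otherwise suppression
  needs distinct outer neighbours; a common one u would leave {a, b, u} joined to the rest only by
  the third edge at u, a cut of size 1.\<close>

lemma digon_or_triple_edge:
  assumes "e1 \<in> E" "e2 \<in> E" "e1 \<noteq> e2" "ends e1 = ends e2"
  shows "(\<exists>a b f. triple_edge V E ends a b e1 e2 f) \<or> (\<exists>a b u w f g. digon V E ends a b u w e1 e2 f g)"
proof -
  obtain a where "a \<in> ends e1" using card_ends[OF assms(1)] by fastforce
  then obtain b where ab: "ends e1 = {a, b}" "b \<noteq> a" "b \<in> V" using ends_at[OF assms(1)] by metis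
  then have aV: "a \<in> V" and e2: "ends e2 = {a, b}" using ends_sub[OF assms(1)] assms(4) by auto
  have mem: "e1 \<in> {e\<in>E. a \<in> ends e}" "e2 \<in> {e\<in>E. a \<in> ends e}" "e1 \<in> {e\<in>E. b \<in> ends e}" "e2 \<in> {e\<in>E. b \<in> ends e}"
    using assms ab e2 by auto
  obtain f where f: "{e\<in>E. a \<in> ends e} = {e1, e2, f}" "f \<noteq> e1" "f \<noteq> e2"
    using third_element[OF three_edges[OF aV] mem(1,2) assms(3)] .
  obtain g where g: "{e\<in>E. b \<in> ends e} = {e1, e2, g}" "g \<noteq> e1" "g \<noteq> e2"
    using third_element[OF three_edges[OF ab(3)] mem(3,4) assms(3)] .
  show ?thesis
  proof (cases "f = g")
    case True
    then have "triple_edge V E ends a b e1 e2 f"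
      using f g ab aV assms(3) by unfold_locales auto
    then show ?thesis by blast
  next
    case False
    have fE: "f \<in> E" "a \<in> ends f" and gE: "g \<in> E" "b \<in> ends g" using f(1) g(1) by blast+
    obtain u where u: "ends f = {a, u}" "u \<noteq> a" "u \<in> V" using ends_at[OF fE] .
    obtain w where w: "ends g = {b, w}" "w \<noteq> b" "w \<in> V" using ends_at[OF gE] .
    have "u \<noteq> b"
    proof
      assume "u = b"
      then have "f \<in> {e\<in>E. b \<in> ends e}" using fE u by auto
      then show False using g f False by simp
    qed
    moreover have "w \<noteq> a"
    proof
      assume "w = a"
      then have "g \<in> {e\<in>E. a \<in> ends e}" using gE w by auto
      then show False using g f False by simp
    qed
    moreover have "u \<noteq> w"
    proof
      assume uw: "u = w"
      have "f \<in> {e\<in>E. u \<in> ends e}" "g \<in> {e\<in>E. u \<in> ends e}" using fE gE u w uw by auto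
      from third_element[OF three_edges[OF u(3)] this False]
      obtain h where h: "{e\<in>E. u \<in> ends e} = {f, g, h}" "h \<noteq> f" "h \<noteq> g" .
      have hE: "h \<in> E" "u \<in> ends h" using h(1) by blast+
      have ue: "u \<notin> ends e1" "u \<notin> ends e2" using ab e2 u uw w by auto
      then have he: "h \<noteq> e1" "h \<noteq> e2" using hE by auto
      have ha: "a \<notin> ends h" "b \<notin> ends h"
      proof
        assume "a \<in> ends h"
        then have "h \<in> {e1, e2, f}" using hE f(1) by blast
        then show False using he h by simp
      next
        show "b \<notin> ends h"
        proof
          assume "b \<in> ends h"
          then have "h \<in> {e1, e2, g}" using hE g(1) by blast
          then show False using he h by simp
        qed
      qed
      obtain z where z: "ends h = {u, z}" "z \<noteq> u" using ends_at[OF hE] by metis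
      have "cut E ends {a, b, u} = {h}"
      proof (rule set_eqI)
        fix e
        show "e \<in> cut E ends {a, b, u} \<longleftrightarrow> e \<in> {h}"
        proof (cases "e \<in> {e1, e2, f, g, h}")
          case True
          then show ?thesis using ab e2 u w uw z ha he h hE by (auto simp: cut_def)
        next
          case False
          then have "e \<in> E \<Longrightarrow> a \<notin> ends e \<and> b \<notin> ends e \<and> u \<notin> ends e" using f(1) g(1) h(1) by blast
          then show ?thesis using False by (auto simp: cut_def)
        qed
      qed
      then have "card (cut E ends {a, b, u}) = 1" by simp
      then show False using bridge_cut_free aV ab u by (auto simp: bridge_cut_free_def)
    qed
    ultimately have "digon V E ends a b u w e1 e2 f g"
      using f g ab e2 aV assms(3) False u w by unfold_locales auto
    then show ?thesis by blast
  qed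
qed

text \<open>Contraction needs distinct third edges at the corners. If two of them were equal, that
  edge would be parallel to a triangle edge.\<close>

lemma triangle_if_no_digon:
  assumes nd: "\<And>e e'. e \<in> E \<Longrightarrow> e' \<in> E \<Longrightarrow> ends e = ends e' \<Longrightarrow> e = e'"
    and eE: "e1 \<in> E" "e2 \<in> E" "e3 \<in> E"
    and ends_e: "ends e1 = {a, b}" "ends e2 = {b, c}" "ends e3 = {a, c}" and dist: "distinct [a, b, c]"
  shows "\<exists>fa fb fc. triangle V E ends a b c e1 e2 e3 fa fb fc"
proof -
  have inV: "a \<in> V" "b \<in> V" "c \<in> V" using ends_sub eE ends_e by blast+
  have de: "e1 \<noteq> e2" "e1 \<noteq> e3" "e2 \<noteq> e3" using ends_e dist by (auto simp: doubleton_eq_iff)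
  have mem: "e1 \<in> {e\<in>E. a \<in> ends e}" "e3 \<in> {e\<in>E. a \<in> ends e}" "e1 \<in> {e\<in>E. b \<in> ends e}"
    "e2 \<in> {e\<in>E. b \<in> ends e}" "e2 \<in> {e\<in>E. c \<in> ends e}" "e3 \<in> {e\<in>E. c \<in> ends e}"
    using eE ends_e by auto
  obtain fa where fa: "{e\<in>E. a \<in> ends e} = {e1, e3, fa}" "fa \<noteq> e1" "fa \<noteq> e3"
    using third_element[OF three_edges[OF inV(1)] mem(1,2) de(2)] .
  obtain fb where fb: "{e\<in>E. b \<in> ends e} = {e1, e2, fb}" "fb \<noteq> e1" "fb \<noteq> e2"
    using third_element[OF three_edges[OF inV(2)] mem(3,4) de(1)] .
  obtain fc where fc: "{e\<in>E. c \<in> ends e} = {e2, e3, fc}" "fc \<noteq> e2" "fc \<noteq> e3"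
    using third_element[OF three_edges[OF inV(3)] mem(5,6) de(3)] .
  have f: "fa \<in> E" "a \<in> ends fa" "fb \<in> E" "b \<in> ends fb" "fc \<in> E" "c \<in> ends fc"
    using fa(1) fb(1) fc(1) by blast+
  have pair: "ends e = {x, y}" if "e \<in> E" "x \<in> ends e" "y \<in> ends e" "x \<noteq> y" for e x y
    using ends_at[OF that(1,2)] that(3,4) by (metis insertE singletonD)
  have "fa \<noteq> e2" "fb \<noteq> e3" "fc \<noteq> e1" using f ends_e dist by auto
  moreover have "fa \<noteq> fb" using pair[of fa a b] f nd[of fa e1] eE ends_e dist fa by auto
  moreover have "fa \<noteq> fc" using pair[of fa a c] f nd[of fa e3] eE ends_e dist fa by auto
  moreover have "fb \<noteq> fc" using pair[of fb b c] f nd[of fb e2] eE ends_e dist fb by auto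
  ultimately have "triangle V E ends a b c e1 e2 e3 fa fb fc"
    using fa fb fc de ends_e dist inV by unfold_locales auto
  then show ?thesis by blast
qed

text \<open>The complement of a perfect matching is a 2-regular spanning graph and so has card V
  edges, which turns the bound of \<open>two_colorable_up_to_odd_cycles\<close> by edges into one by
  vertices.\<close>

lemma colorable_deleting_if_girth_ge_4:
  assumes nd: "\<And>e e'. e \<in> E \<Longrightarrow> e' \<in> E \<Longrightarrow> ends e = ends e' \<Longrightarrow> e = e'"
    and nt: "\<And>a b c e1 e2 e3. e1 \<in> E \<Longrightarrow> e2 \<in> E \<Longrightarrow> e3 \<in> E \<Longrightarrow> ends e1 = {a, b} \<Longrightarrow>
      ends e2 = {b, c} \<Longrightarrow> ends e3 = {a, c} \<Longrightarrow> distinct [a, b, c] \<Longrightarrow> False"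
  shows "\<exists>k. colorable_deleting E ends k \<and> 5 * k \<le> card V"
proof -
  obtain M where M: "matching E ends M" "\<Union>(ends ` M) = V"
    using petersen_perfect_matching[OF graph cubic bridge_cut_free] .
  let ?F = "E - M"
  have ME: "M \<subseteq> E" using M by (simp add: matching_def)
  have fF: "finite ?F" using finite_E by simp
  have c2F: "card (ends e) = 2" if "e \<in> ?F" for e using that card_ends by auto
  have deg2: "degree ?F ends v = 2" if v: "v \<in> V" for v
  proof -
    obtain m where m: "m \<in> M" "v \<in> ends m" using M(2) v by blast
    have "{e\<in>?F. v \<in> ends e} = {e\<in>E. v \<in> ends e} - {m}"
      using m M(1) unfolding matching_def by blast
    then show ?thesis using m ME three_edges[OF v] finite_E by (auto simp: degree_def)
  qed
  have deg: "degree ?F ends v \<le> 2" for v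
  proof (cases "v \<in> V")
    case False
    then have "degree ?F ends v = 0" using fF ends_sub by (auto simp: degree_0_iff)
    then show ?thesis by simp
  qed (simp add: deg2)
  \<comment> \<open>An edge of D and its successors at both ends are three distinct edges, for lack
    of parallel edges. If they were all of D, the degrees 2 would close them into a triangle; by
    parity D then has at least five edges.\<close>
  have long: "5 \<le> card D" if D: "D \<subseteq> ?F" "even_regular ends D" "odd (card D)" for D
  proof -
    have fD: "finite D" using D(1) fF by (rule finite_subset)
    have DE: "D \<subseteq> E" using D(1) by blast
    have other: "\<exists>h\<in>D. h \<noteq> e \<and> v \<in> ends h" if "e \<in> D" "v \<in> ends e" for e v
    proof -
      have "degree D ends v \<noteq> 0" using fD that by (auto simp: degree_0_iff)
      then have "degree D ends v = 2" using D(2) by (metis even_regular_def)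
      then show ?thesis using other_end[of "{g\<in>D. v \<in> ends g}" e] that
        unfolding degree_def by (metis (mono_tags, lifting) insertI1 insertI2 mem_Collect_eq)
    qed
    have "D \<noteq> {}" using D(3) by auto
    then obtain e where e: "e \<in> D" by blast
    obtain a b where ab: "ends e = {a, b}" "a \<noteq> b" using card_ends[of e] e DE by (auto simp: card_2_iff)
    obtain h where h: "h \<in> D" "h \<noteq> e" "a \<in> ends h" using other[OF e, of a] ab by auto
    obtain l where l: "l \<in> D" "l \<noteq> e" "b \<in> ends l" using other[OF e, of b] ab by auto
    obtain c where c: "ends h = {a, c}" "c \<noteq> a" using ends_at[of h a] h DE by blast
    obtain d where d: "ends l = {b, d}" "d \<noteq> b" using ends_at[of l b] l DE by blast
    have "c \<noteq> b" using nd[of h e] h e DE c ab by auto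
    moreover have "d \<noteq> a" using nd[of l e] l e DE d ab by (auto simp: insert_commute)
    ultimately have hl: "h \<noteq> l" using h c l d ab by auto
    have "card {e, h, l} \<le> card D" using e h l fD by (intro card_mono) auto
    then have ge3: "3 \<le> card D" using h l hl by simp
    have "card D \<noteq> 3"
    proof
      assume c3: "card D = 3"
      then have "D = {e, h, l}" using e h l hl fD by (intro card_seteq[symmetric]) auto
      moreover obtain m where "m \<in> D" "m \<noteq> h" "c \<in> ends m" using other[OF h(1), of c] c by auto
      ultimately have "c \<in> ends l" using ab c \<open>c \<noteq> b\<close> by auto
      then have "c = d" using d \<open>c \<noteq> b\<close> by auto
      then show False using nt[of e l h a b c] e l h DE ab c d \<open>c \<noteq> b\<close> by auto
    qed
    moreover have "odd n \<Longrightarrow> 3 \<le> n \<Longrightarrow> n \<noteq> 3 \<Longrightarrow> 5 \<le> n" for n :: nat by presburger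
    ultimately show ?thesis using D(3) ge3 by blast
  qed
  obtain R col where R: "R \<subseteq> ?F" "proper ends 2 (?F - R) col" "5 * card R \<le> card ?F"
    using two_colorable_up_to_odd_cycles[of ?F ends] fF c2F deg long by blast
  have "2 * card V = (\<Sum>v\<in>V. degree ?F ends v)" using deg2 by simp
  also have "\<dots> = (\<Sum>e\<in>?F. card (ends e \<inter> V))" by (rule sum_degree[OF fF finite_V])
  also have "\<dots> = 2 * card ?F" using c2F ends_sub by (simp add: Int_absorb2)
  finally have "card ?F = card V" by simp
  have lt2: "col e < 2" if "e \<in> E - R" "e \<notin> M" for e
    using R(2) that unfolding proper_def by blast
  have "proper ends 3 (E - R) (\<lambda>e. if e \<in> M then 2 else col e)"
    unfolding proper_def
  proof (intro conjI ballI impI)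
    fix e assume "e \<in> E - R"
    then show "(if e \<in> M then 2 else col e) < 3" using lt2[of e] by auto
  next
    fix e f assume ef: "e \<in> E - R" "f \<in> E - R" "e \<noteq> f \<and> ends e \<inter> ends f \<noteq> {}"
    have "\<not> (e \<in> M \<and> f \<in> M)" using ef(3) M(1) unfolding matching_def by blast
    moreover have "col e \<noteq> col f" if "e \<notin> M" "f \<notin> M"
      using R(2) that ef unfolding proper_def by blast
    ultimately show "(if e \<in> M then 2 else col e) \<noteq> (if f \<in> M then 2 else col f)"
      using lt2[of e] lt2[of f] ef(1,2) by auto
  qed
  then have "colorable_deleting E ends (card R)"
    using R(1) unfolding colorable_deleting_def by blast
  then show ?thesis using R(3) \<open>card ?F = card V\<close> by auto
qed

end

section \<open>Induction over the reductions\<close>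

lemma card_Diff_two:
  assumes "finite V" "a \<in> V" "b \<in> V" "a \<noteq> b"
  shows "card V = card (V - {a, b}) + 2"
proof -
  have "card {a, b} \<le> card V" using assms by (intro card_mono) auto
  then show ?thesis using assms by (simp add: card_Diff_subset)
qed

text \<open>The set S consists of the contracted vertices, which have weight 3.\<close>

lemma colorable_deleting_bound:
  assumes "cubic_graph V E ends" "S \<subseteq> V" "\<And>v. v \<in> V - S \<Longrightarrow> near_triangle E ends v"
  shows "\<exists>k. colorable_deleting E ends k \<and> 15 * k \<le> card V + 2 * card S"
  using assms
proof (induction "card V" arbitrary: V E ends S rule: less_induct)
  case less
  interpret cubic_graph V E ends by (rule less.prems(1))
  have fS: "finite S" using less.prems(2) finite_V by (rule finite_subset)
  show ?case
  proof (cases "\<exists>e1\<in>E. \<exists>e2\<in>E. e1 \<noteq> e2 \<and> ends e1 = ends e2")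
    case True
    then obtain e1 e2 where digon: "e1 \<in> E" "e2 \<in> E" "e1 \<noteq> e2" "ends e1 = ends e2" by blast
    from digon_or_triple_edge[OF digon] show ?thesis
    proof (elim disjE exE)
      fix a b f assume "triple_edge V E ends a b e1 e2 f"
      then interpret triple_edge V E ends a b e1 e2 f .
      have cV: "card V = card V' + 2" using finite_V ab by (intro card_Diff_two) auto
      then have "card V' < card V" by simp
      moreover have "S - {a, b} \<subseteq> V'" using less.prems(2) by auto
      ultimately have "\<exists>k. colorable_deleting E' ends k \<and> 15 * k \<le> card V' + 2 * card (S - {a, b})"
        by (rule less.hyps[OF _ reduced]) (rule near_triangle_reduced, use less.prems(3) in auto)
      then obtain k where k: "colorable_deleting E' ends k" "15 * k \<le> card V' + 2 * card (S - {a, b})" by blast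
      have "card (S - {a, b}) \<le> card S" using fS by (intro card_mono) auto
      then show ?thesis using colorable_lift[OF k(1)] k(2) cV by (intro exI[of _ k]) auto
    next
      fix a b u w f g assume "digon V E ends a b u w e1 e2 f g"
      then interpret digon V E ends a b u w e1 e2 f g .
      have cV: "card V = card V' + 2" using finite_V in_V v_distinct by (intro card_Diff_two) auto
      then have "card V' < card V" by simp
      moreover have "S - {a, b} \<subseteq> V'" using less.prems(2) by auto
      ultimately have "\<exists>k. colorable_deleting E' ends' k \<and> 15 * k \<le> card V' + 2 * card (S - {a, b})"
        by (rule less.hyps[OF _ reduced]) (rule near_triangle_reduced, use less.prems(3) in auto)
      then obtain k where k: "colorable_deleting E' ends' k" "15 * k \<le> card V' + 2 * card (S - {a, b})" by blast
      have "card (S - {a, b}) \<le> card S" using fS by (intro card_mono) auto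
      then show ?thesis using colorable_lift[OF k(1)] k(2) cV by (intro exI[of _ k]) auto
    qed
  next
    case False
    then have simple: "\<And>e e'. e \<in> E \<Longrightarrow> e' \<in> E \<Longrightarrow> ends e = ends e' \<Longrightarrow> e = e'" by blast
    show ?thesis
    proof (cases "\<exists>e1\<in>E. \<exists>e2\<in>E. \<exists>e3\<in>E. \<exists>a b c. ends e1 = {a, b} \<and> ends e2 = {b, c} \<and> ends e3 = {a, c} \<and> distinct [a, b, c]")
      case True
      then obtain a b c e1 e2 e3 where triangle: "e1 \<in> E" "e2 \<in> E" "e3 \<in> E"
        "ends e1 = {a, b}" "ends e2 = {b, c}" "ends e3 = {a, c}" "distinct [a, b, c]"
        by (elim bexE exE conjE) (rule that)
      from triangle_if_no_digon[OF simple triangle] obtain fa fb fc where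
        "triangle V E ends a b c e1 e2 e3 fa fb fc" by blast
      then interpret triangle V E ends a b c e1 e2 e3 fa fb fc .
      have cV: "card V = card V' + 2" using finite_V in_V v_distinct by (intro card_Diff_two) auto
      \<comment> \<open>\<open>a\<close> joins S because its triangle may be gone. The vertex count
        drops by 2 and 2 * card S grows by at most 2, so the bound does not grow.\<close>
      let ?S = "insert a (S - {b, c})"
      have "card V' < card V" using cV by simp
      moreover have "?S \<subseteq> V'" using less.prems(2) in_V v_distinct by auto
      ultimately have "\<exists>k. colorable_deleting E' ends' k \<and> 15 * k \<le> card V' + 2 * card ?S"
        by (rule less.hyps[OF _ reduced]) (rule near_triangle_reduced, use less.prems(3) in auto)
      then obtain k where k: "colorable_deleting E' ends' k" "15 * k \<le> card V' + 2 * card ?S" by blast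
      have "card ?S \<le> Suc (card (S - {b, c}))" by (rule card_insert_le_m1) auto
      also have "card (S - {b, c}) \<le> card S" using fS by (intro card_mono) auto
      finally have "card ?S \<le> Suc (card S)" by simp
      then show ?thesis using colorable_lift[OF k(1)] k(2) cV by (intro exI[of _ k]) auto
    next
      case False
      then have triangle_free: False if "e1 \<in> E" "e2 \<in> E" "e3 \<in> E" "ends e1 = {a, b}" "ends e2 = {b, c}"
        "ends e3 = {a, c}" "distinct [a, b, c]" for a b c e1 e2 e3
        using that by blast
      have "\<exists>k. colorable_deleting E ends k \<and> 5 * k \<le> card V"
      proof (rule colorable_deleting_if_girth_ge_4)
        show "e = e'" if "e \<in> E" "e' \<in> E" "ends e = ends e'" for e e'
          by (rule simple[OF that])
        show False if "e1 \<in> E" "e2 \<in> E" "e3 \<in> E" "ends e1 = {a, b}" "ends e2 = {b, c}"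
          "ends e3 = {a, c}" "distinct [a, b, c]" for a b c e1 e2 e3
          by (rule triangle_free[OF that])
      qed
      then obtain k where k: "colorable_deleting E ends k" "5 * k \<le> card V" by blast
      \<comment> \<open>Where no reduction applies, no vertex lies on a triangle or a digon, so all
        vertices belong to S. Then card V + 2 * card S equals 3 * card V, and 5 * k \<le> card V
        suffices.\<close>
      have "\<not> near_triangle E ends v" for v
      proof
        assume "near_triangle E ends v"
        then obtain h1 h2 x y where h: "h1 \<in> E" "h2 \<in> E" "h1 \<noteq> h2" "ends h1 = {v, x}" "ends h2 = {v, y}"
          "x = y \<or> (\<exists>h3\<in>E. ends h3 = {x, y})" by (rule near_triangleE)
        have "x \<noteq> y" using simple h by metis
        then obtain h3 where h3: "h3 \<in> E" "ends h3 = {x, y}" using h(6) by blast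
        have "v \<noteq> x" "v \<noteq> y" using card_ends[OF h(1)] card_ends[OF h(2)] h by auto
        then show False using triangle_free[of h1 h3 h2 v x y] h h3 \<open>x \<noteq> y\<close> by (auto simp: insert_commute)
      qed
      then have "S = V" using less.prems by auto
      then show ?thesis using k by (intro exI[of _ k]) auto
    qed
  qed
qed

text \<open>Without a triangle or digon at v, its three neighbours are distinct and pairwise
  nonadjacent, and distinctness makes each edge at v simple. This is a claw with exactly the
  multiplicities that \<open>claw_free\<close> forbids.\<close>

lemma claw_free_near_triangle:
  assumes "cubic_graph V E ends" "claw_free V E ends" "v \<in> V"
  shows "near_triangle E ends v"
proof (rule ccontr)
  assume n: "\<not> ?thesis"
  interpret cubic_graph V E ends by (rule assms(1))
  obtain h1 h2 h3 where h: "{e\<in>E. v \<in> ends e} = {h1, h2, h3}" "h1 \<noteq> h2" "h1 \<noteq> h3" "h2 \<noteq> h3"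
    using three_edges[OF assms(3)] by (auto simp: card_3_iff)
  have hE: "h1 \<in> E" "v \<in> ends h1" "h2 \<in> E" "v \<in> ends h2" "h3 \<in> E" "v \<in> ends h3" using h(1) by blast+
  obtain x where x: "ends h1 = {v, x}" "x \<noteq> v" "x \<in> V" using ends_at[OF hE(1,2)] .
  obtain y where y: "ends h2 = {v, y}" "y \<noteq> v" "y \<in> V" using ends_at[OF hE(3,4)] .
  obtain z where z: "ends h3 = {v, z}" "z \<noteq> v" "z \<in> V" using ends_at[OF hE(5,6)] .
  have far: "p \<noteq> q \<and> mult E ends p q = 0"
    if "k \<in> E" "l \<in> E" "k \<noteq> l" "ends k = {v, p}" "ends l = {v, q}" for k l p q
  proof -
    have "\<not> (p = q \<or> (\<exists>h\<in>E. ends h = {p, q}))"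
      using n that unfolding near_triangle_def by blast
    then have "p \<noteq> q" "{e\<in>E. ends e = {p, q}} = {}" by blast+
    then show ?thesis by (simp add: mult_def del: Collect_empty_eq)
  qed
  have xy: "x \<noteq> y \<and> mult E ends x y = 0" by (rule far[OF hE(1) hE(3) h(2) x(1) y(1)])
  have xz: "x \<noteq> z \<and> mult E ends x z = 0" by (rule far[OF hE(1) hE(5) h(3) x(1) z(1)])
  have yz: "y \<noteq> z \<and> mult E ends y z = 0" by (rule far[OF hE(3) hE(5) h(4) y(1) z(1)])
  have simple: "mult E ends v p = 1"
    if hp: "k \<in> E" "ends k = {v, p}" "\<And>l. l \<in> {h1, h2, h3} \<Longrightarrow> l \<noteq> k \<Longrightarrow> ends l \<noteq> {v, p}" for k p
  proof -
    have "e \<in> {h1, h2, h3}" if "e \<in> E" "ends e = {v, p}" for e using that h(1) by blast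
    then have "{e\<in>E. ends e = {v, p}} = {k}" using hp by blast
    then show ?thesis by (simp add: mult_def)
  qed
  have "mult E ends v x = 1" by (rule simple[OF hE(1) x(1)]) (use x y z xy xz yz in \<open>auto simp: doubleton_eq_iff\<close>)
  moreover have "mult E ends v y = 1" by (rule simple[OF hE(3) y(1)]) (use x y z xy xz yz in \<open>auto simp: doubleton_eq_iff\<close>)
  moreover have "mult E ends v z = 1" by (rule simple[OF hE(5) z(1)]) (use x y z xy xz yz in \<open>auto simp: doubleton_eq_iff\<close>)
  moreover have "distinct [v, x, y, z]" using x y z xy xz yz by auto
  ultimately show False using assms(2,3) x(3) y(3) z(3) xy xz yz unfolding claw_free_def by blast
qed

theorem theorem10:
  fixes V :: "'v set" and E :: "'e set" and ends :: "'e \<Rightarrow> 'v set"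
  assumes "multigraph V E ends"
    and "cubic V E ends"
    and "bridgeless V E ends"
    and "claw_free V E ends"
  shows "real (nu3 E ends) \<ge> 43 / 45 * real (card E)"
proof -
  interpret cubic_graph V E ends
    using assms bridgeless_imp_bridge_cut_free by unfold_locales auto
  \<comment> \<open>At the start no vertex has been contracted, so S is empty.\<close>
  have "\<exists>k. colorable_deleting E ends k \<and> 15 * k \<le> card V + 2 * card ({} :: 'v set)"
    using claw_free_near_triangle[OF cubic_graph_axioms assms(4)]
    by (intro colorable_deleting_bound[OF cubic_graph_axioms]) auto
  then obtain R col where R: "R \<subseteq> E" "proper ends 3 (E - R) col" "15 * card R \<le> card V"
    by (auto simp: colorable_deleting_def)
  have "3 * card V = (\<Sum>v\<in>V. degree E ends v)" using cubic by (simp add: cubic_def)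
  also have "\<dots> = (\<Sum>e\<in>E. card (ends e \<inter> V))" by (rule sum_degree[OF finite_E finite_V])
  also have "\<dots> = 2 * card E" using card_ends ends_sub by (simp add: Int_absorb2)
  finally have EV: "3 * card V = 2 * card E" .
  have "three_edge_colorable (E - R) ends"
    using R(2) unfolding three_edge_colorable_def proper_def by blast
  then have "card (E - R) \<in> {card F | F. F \<subseteq> E \<and> three_edge_colorable F ends}" by blast
  moreover have "finite {card F | F. F \<subseteq> E \<and> three_edge_colorable F ends}"
    by (rule finite_subset[of _ "card ` Pow E"]) (blast, simp add: finite_E)
  ultimately have "card (E - R) \<le> nu3 E ends" unfolding nu3_def by (rule Max_ge[rotated])
  moreover have "card (E - R) = card E - card R" "card R \<le> card E"
    using card_Diff_subset[OF finite_subset[OF R(1) finite_E] R(1)] card_mono[OF finite_E R(1)] by simp_all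
  ultimately have "card E \<le> nu3 E ends + card R" by linarith
  then have "45 * real (card E) \<le> 45 * real (nu3 E ends) + 45 * real (card R)" by linarith
  \<comment> \<open>The bound 15 * card R \<le> card V is tripled and 3 * card V replaced by 2 *
    card E; this accounts for 43 = 45 - 2.\<close>
  moreover have "45 * real (card R) \<le> 2 * real (card E)" using R(3) EV by linarith
  ultimately show ?thesis by linarith
qed

end
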